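(* Let $\alpha$ be an integer with $\alpha\notin\{0,1,2\}$, let $p$ be a prime factor of $\alpha-1$, let $m=v_p(\alpha-1)$, and let $J$ be the Sylow $p$-subgroup of the Macdonald group $G(\alpha)$. Then $J$ has the presentation $$\langle x,y\mid x^{[x,y]}=x^\alpha,\ y^{[y,x]}=y^\alpha,\ x^{p^{3m}}=1,\ y^{p^{3m}}=1\rangle\quad\text{in Case 1},$$ $$\langle x,y\mid x^{[x,y]}=x^\alpha,\ y^{[y,x]}=y^\alpha,\ x^{2^{3m-1}}=1,\ y^{2^{3m-1}}=1\rangle\quad\text{in Case 2},$$ $$\langle x,y\mid x^{[x,y]}=x^\alpha,\ y^{[y,x]}=y^\alpha,\ x^{81}=1,\ y^{81}=1\rangle\quad\text{in Case 3}.$$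
   Context: For elements $a,b$ of a group, $[a,b]=a^{-1}b^{-1}ab$ and $b^a=a^{-1}ba$. The Macdonald group is $G(\alpha)=\langle A,B\mid A^{[A,B]}=A^\alpha,\ B^{[B,A]}=B^\alpha\rangle$; for $\alpha\notin\{0,1,2\}$ it is finite and nilpotent, and its order has the same prime factors as $\alpha-1$, so it has a unique Sylow $p$-subgroup. $v_p$ denotes the $p$-adic valuation. Case 1: either $p>3$, or $p=3$ and ($m>1$ or $(\alpha-1)/3\equiv 1 \bmod 3$). Case 2: $p=2$. Case 3: $p=3$, $m=1$, and $(\alpha-1)/3\equiv -1\bmod 3$. *)

theory Defs
  imports "HOL-Algebra.Algebra" "HOL-Number_Theory.Number_Theory"
begin

section \<open>Groups given by generators and relations\<close>

text \<open>A letter \<open>(g, True)\<close> stands for the generator \<open>g\<close>, and \<open>(g, False)\<close> for its inverse.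
  The generating set is always the whole type \<open>'g\<close>. A relation \<open>u = v\<close> is a pair of words.\<close>

type_synonym 'g word = "('g \<times> bool) list"

definition gen :: "'g \<Rightarrow> 'g word" where
  "gen g = [(g, True)]"

definition word_inv :: "'g word \<Rightarrow> 'g word" where
  "word_inv w = rev (map (\<lambda>(g, b). (g, \<not> b)) w)"

definition word_pow :: "'g word \<Rightarrow> int \<Rightarrow> 'g word" where
  "word_pow w k =
     (if 0 \<le> k then concat (replicate (nat k) w)
      else concat (replicate (nat (- k)) (word_inv w)))"

text \<open>The conventions are \<open>b\<^sup>a = a\<^sup>-\<^sup>1 b a\<close> and \<open>[a, b] = a\<^sup>-\<^sup>1 b\<^sup>-\<^sup>1 a b\<close>.\<close>

definition word_conj :: "'g word \<Rightarrow> 'g word \<Rightarrow> 'g word" where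
  "word_conj b a = word_inv a @ b @ a"

definition word_comm :: "'g word \<Rightarrow> 'g word \<Rightarrow> 'g word" where
  "word_comm a b = word_inv a @ word_inv b @ a @ b"

inductive word_equiv :: "('g word \<times> 'g word) set \<Rightarrow> 'g word \<Rightarrow> 'g word \<Rightarrow> bool"
  for R :: "('g word \<times> 'g word) set" where
  rel: "(u, v) \<in> R \<Longrightarrow> word_equiv R u v"
| cancel: "word_equiv R [(g, b), (g, \<not> b)] []"
| refl: "word_equiv R u u"
| sym: "word_equiv R u v \<Longrightarrow> word_equiv R v u"
| trans: "word_equiv R u v \<Longrightarrow> word_equiv R v w \<Longrightarrow> word_equiv R u w"
| append: "word_equiv R u u' \<Longrightarrow> word_equiv R v v' \<Longrightarrow> word_equiv R (u @ v) (u' @ v')"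

definition word_class :: "('g word \<times> 'g word) set \<Rightarrow> 'g word \<Rightarrow> 'g word set" where
  "word_class R w = {v. word_equiv R w v}"

definition presented_group :: "('g word \<times> 'g word) set \<Rightarrow> 'g word set monoid" where
  "presented_group R =
     \<lparr>carrier = range (word_class R),
      monoid.mult = (\<lambda>U V. {w. \<exists>u\<in>U. \<exists>v\<in>V. word_equiv R (u @ v) w}),
      monoid.one = word_class R []\<rparr>"

lemma word_class_eq_iff: "word_class R u = word_class R v \<longleftrightarrow> word_equiv R u v"
  unfolding word_class_def by (auto intro: word_equiv.intros)

lemma carrier_presented_group: "carrier (presented_group R) = range (word_class R)"
  by (simp add: presented_group_def)

lemma one_presented_group: "\<one>\<^bsub>presented_group R\<^esub> = word_class R []"
  by (simp add: presented_group_def)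

lemma mult_presented_group:
  "word_class R u \<otimes>\<^bsub>presented_group R\<^esub> word_class R v = word_class R (u @ v)"
proof -
  have "(\<exists>u'. word_equiv R u u' \<and> (\<exists>v'. word_equiv R v v' \<and> word_equiv R (u' @ v') w))
          \<longleftrightarrow> word_equiv R (u @ v) w" for w
    by (meson word_equiv.append word_equiv.refl word_equiv.trans)
  then show ?thesis
    by (simp add: presented_group_def word_class_def)
qed

lemma word_equiv_inv_left: "word_equiv R (word_inv w @ w) []"
proof (induction w)
  case Nil
  show ?case by (simp add: word_inv_def word_equiv.refl)
next
  case (Cons l w)
  obtain g b where l: "l = (g, b)" by (cases l)
  have c: "word_equiv R [(g, \<not> b), (g, b)] []"
    using word_equiv.cancel[of R g "\<not> b"] by simp
  have "word_equiv R (word_inv w @ ([(g, \<not> b), (g, b)] @ w)) (word_inv w @ ([] @ w))"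
    by (intro word_equiv.append word_equiv.refl c)
  then show ?case
    using Cons.IH by (auto simp: l word_inv_def intro: word_equiv.trans)
qed

lemma group_presented_group: "group (presented_group R)"
proof (rule groupI)
  fix x assume "x \<in> carrier (presented_group R)"
  then obtain w where "x = word_class R w"
    by (auto simp: carrier_presented_group)
  then show "\<exists>y\<in>carrier (presented_group R). y \<otimes>\<^bsub>presented_group R\<^esub> x = \<one>\<^bsub>presented_group R\<^esub>"
    by (auto simp: carrier_presented_group one_presented_group mult_presented_group
        word_class_eq_iff intro: word_equiv_inv_left)
qed (auto simp: carrier_presented_group one_presented_group mult_presented_group)

text \<open>The universal property: an assignment of the generators that satisfies all relations
  extends to a homomorphism on the presented group.\<close>

definition word_eval :: "('a, 'b) monoid_scheme \<Rightarrow> ('g \<Rightarrow> 'a) \<Rightarrow> 'g word \<Rightarrow> 'a" where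
  "word_eval G f w =
     foldr (\<lambda>(g, b) r. (if b then f g else inv\<^bsub>G\<^esub> (f g)) \<otimes>\<^bsub>G\<^esub> r) w \<one>\<^bsub>G\<^esub>"

context group
begin

lemma word_eval_closed:
  assumes "\<And>g. f g \<in> carrier G"
  shows "word_eval G f w \<in> carrier G"
  using assms by (induction w) (auto simp: word_eval_def)

lemma word_eval_append:
  assumes "\<And>g. f g \<in> carrier G"
  shows "word_eval G f (u @ v) = word_eval G f u \<otimes> word_eval G f v"
proof (induction u)
  case Nil
  show ?case using word_eval_closed[of f v, OF assms] by (simp add: word_eval_def)
next
  case (Cons l u)
  obtain g b where l: "l = (g, b)" by (cases l)
  have "word_eval G f ((l # u) @ v)
          = (if b then f g else inv (f g)) \<otimes> word_eval G f (u @ v)"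
    by (simp add: word_eval_def l)
  also have "\<dots> = ((if b then f g else inv (f g)) \<otimes> word_eval G f u) \<otimes> word_eval G f v"
    using Cons.IH assms word_eval_closed[of f, OF assms] by (simp add: m_assoc)
  finally show ?case by (simp add: word_eval_def l)
qed

lemma word_eval_equiv:
  assumes f: "\<And>g. f g \<in> carrier G"
    and R: "\<And>u v. (u, v) \<in> R \<Longrightarrow> word_eval G f u = word_eval G f v"
    and "word_equiv R u v"
  shows "word_eval G f u = word_eval G f v"
  using assms(3)
proof (induction rule: word_equiv.induct)
  case (cancel g b)
  then show ?case using f by (simp add: word_eval_def)
qed (auto simp: R word_eval_append f)

lemma presented_group_universal:
  assumes f: "\<And>g. f g \<in> carrier G"
    and R: "\<And>u v. (u, v) \<in> R \<Longrightarrow> word_eval G f u = word_eval G f v"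
  shows "\<exists>h \<in> hom (presented_group R) G. \<forall>w. h (word_class R w) = word_eval G f w"
proof
  let ?h = "\<lambda>U. word_eval G f (SOME w. U = word_class R w)"
  have h: "?h (word_class R w) = word_eval G f w" for w
  proof -
    have "word_class R w = word_class R (SOME v. word_class R w = word_class R v)"
      by (rule someI) (rule HOL.refl)
    then show ?thesis
      using word_eval_equiv[OF f R] by (metis word_class_eq_iff)
  qed
  then show "\<forall>w. ?h (word_class R w) = word_eval G f w" by blast
  show "?h \<in> hom (presented_group R) G"
    by (rule homI)
      (auto simp: carrier_presented_group mult_presented_group h word_eval_append f
        word_eval_closed)
qed

end


section \<open>Macdonald groups and Sylow subgroups\<close>

datatype two_gens = Gen_x | Gen_y

definition macdonald_rels :: "int \<Rightarrow> (two_gens word \<times> two_gens word) set" where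
  "macdonald_rels \<alpha> =
     {(word_conj (gen Gen_x) (word_comm (gen Gen_x) (gen Gen_y)), word_pow (gen Gen_x) \<alpha>),
      (word_conj (gen Gen_y) (word_comm (gen Gen_y) (gen Gen_x)), word_pow (gen Gen_y) \<alpha>)}"

definition macdonald_group :: "int \<Rightarrow> two_gens word set monoid" where
  "macdonald_group \<alpha> = presented_group (macdonald_rels \<alpha>)"

definition macdonald_exp_group :: "int \<Rightarrow> nat \<Rightarrow> two_gens word set monoid" where
  "macdonald_exp_group \<alpha> e =
     presented_group (macdonald_rels \<alpha> \<union>
       {(word_pow (gen Gen_x) (int e), []), (word_pow (gen Gen_y) (int e), [])})"

text \<open>This is the usual notion for a finite group \<open>G\<close>; it is not meant to be
  used for infinite \<open>G\<close>, where \<open>order G = 0\<close>.\<close>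

definition sylow_subgroup :: "nat \<Rightarrow> 'a set \<Rightarrow> ('a, 'b) monoid_scheme \<Rightarrow> bool" where
  "sylow_subgroup p J G \<longleftrightarrow> subgroup J G \<and> card J = p ^ multiplicity p (order G)"

end

theory Submission
  imports Defs
begin

text \<open>Write \<open>C = [A, B]\<close>. The relations say \<open>A C = C A\<^sup>\<alpha>\<close>, \<open>C B = B\<^sup>\<alpha> C\<close> and \<open>A B = B A C\<close>.
  Evaluating \<open>A B\<^sup>M C\<^sup>j\<close> for \<open>M = \<alpha>\<^sup>j\<close> in two ways shows that a power of \<open>A\<close> equals a power of
  \<open>B\<close>; it is therefore central, and \<open>A\<close> and \<open>B\<close> are killed by
  \<open>D j = 1 - \<alpha>\<^sup>M (1 - (\<alpha> - 1) \<alpha>\<^bsup>j - 1\<^esup>)\<close>. A prime dividing all \<open>D j\<close> divides \<open>\<alpha> - 1\<close>, and the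
  \<open>p\<close>-adic valuation of \<open>D 1\<close> or of \<open>D 2\<close> is at most the exponent claimed in the theorem.

  If \<open>A\<^bsup>q k\<^esup> = B\<^bsup>q k\<^esup> = 1\<close> for a prime \<open>q\<close> and all primes dividing \<open>q k\<close> divide \<open>\<alpha> - 1\<close>, then
  \<open>C\<^sup>k\<close> is central of order dividing \<open>q\<close>, and modulo it so are \<open>A\<^sup>k\<close> and \<open>B\<^sup>k\<close>. Peeling off one
  prime at a time in this way, first all primes other than \<open>p\<close>, gives finiteness and a normal
  \<open>p'\<close>-subgroup with a \<open>p\<close>-group as quotient; a Sylow \<open>p\<close>-subgroup meets the former trivially and
  maps isomorphically onto the group with the two additional relations.\<close>

section \<open>Consequences of the Macdonald relations\<close>

definition pow_sum :: "int \<Rightarrow> nat \<Rightarrow> int" where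
  "pow_sum \<alpha> k = (\<Sum>i<k. \<alpha> ^ i)"

lemma pow_sum_0 [simp]: "pow_sum \<alpha> 0 = 0"
  by (simp add: pow_sum_def)

lemma pow_sum_Suc: "pow_sum \<alpha> (Suc k) = 1 + \<alpha> * pow_sum \<alpha> k"
  unfolding pow_sum_def sum.lessThan_Suc_shift by (simp add: sum_distrib_left)

lemma pow_sum_geometric: "(\<alpha> - 1) * pow_sum \<alpha> k = \<alpha> ^ k - 1"
  by (induction k) (simp_all add: pow_sum_Suc algebra_simps)

section \<open>Powers in conjugation relations, where \<open>x \<otimes> y = y \<otimes> z\<close>
  encodes \<open>z = y^-1 x y\<close>\<close>

context group
begin

lemma conj_rel_inv:
  assumes "x \<in> carrier G" "y \<in> carrier G" "z \<in> carrier G" and "x \<otimes> y = y \<otimes> z"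
  shows "inv y \<otimes> x = z \<otimes> inv y"
proof -
  have "x = y \<otimes> z \<otimes> inv y"
    using assms inv_solve_right[of x "y \<otimes> z" y] by simp
  then show ?thesis
    using assms by (simp add: m_assoc[symmetric])
qed

lemma int_pow_conj_rel:
  assumes "x \<in> carrier G" "y \<in> carrier G" "z \<in> carrier G" and "x \<otimes> y = y \<otimes> z"
  shows "x [^] (i::int) \<otimes> y = y \<otimes> z [^] i"
proof -
  have nat: "x [^] (n::nat) \<otimes> y = y \<otimes> z [^] n" for n
  proof (induction n)
    case (Suc n)
    have "x [^] Suc n \<otimes> y = x [^] n \<otimes> (x \<otimes> y)"
      using assms(1-3) by (simp add: m_assoc)
    also have "\<dots> = x [^] n \<otimes> y \<otimes> z"
      using assms(1-3) unfolding assms(4) by (simp add: m_assoc)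
    also have "\<dots> = y \<otimes> z [^] Suc n"
      using assms(1-3) unfolding Suc.IH by (simp add: m_assoc)
    finally show ?case .
  qed (use assms(1-3) in simp)
  have neg: "inv (x [^] n) \<otimes> y = y \<otimes> inv (z [^] n)" for n :: nat
  proof -
    have "z [^] n = inv y \<otimes> x [^] n \<otimes> y"
      using nat[of n] assms(1-3) by (simp add: m_assoc) (simp add: m_assoc[symmetric])
    then have "inv (z [^] n) = inv y \<otimes> inv (x [^] n) \<otimes> y"
      using assms(1-3) by (simp add: inv_mult_group m_assoc)
    then show ?thesis
      using assms(1-3) by (simp add: m_assoc[symmetric])
  qed
  show ?thesis
    unfolding int_pow_def2 using nat neg by (auto simp del: pow_nat)
qed

text \<open>Each passage across a factor \<open>y\<close> multiplies the exponent of
  \<open>x\<close> by \<beta>.\<close>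

lemma int_pow_conj_pow_rel:
  assumes x: "x \<in> carrier G" and y: "y \<in> carrier G" and xy: "x \<otimes> y = y \<otimes> x [^] (\<beta>::int)"
  shows "x [^] (i::int) \<otimes> y [^] (k::nat) = y [^] k \<otimes> x [^] (i * \<beta> ^ k)"
proof (induction k arbitrary: i)
  case (Suc k)
  have "x [^] i \<otimes> y [^] Suc k = x [^] i \<otimes> y [^] k \<otimes> y"
    using x y by (simp add: m_assoc)
  also have "\<dots> = y [^] k \<otimes> (x [^] (i * \<beta> ^ k) \<otimes> y)"
    using x y unfolding Suc.IH by (simp add: m_assoc)
  also have "x [^] (i * \<beta> ^ k) \<otimes> y = y \<otimes> x [^] (i * \<beta> ^ Suc k)"
    using int_pow_conj_rel[OF x y _ xy, of "i * \<beta> ^ k"] x by (simp add: int_pow_pow ac_simps)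
  finally show ?case
    using x y by (simp add: m_assoc)
qed (use x in simp)

end

text \<open>The third relation is \<open>C B C\<^sup>-\<^sup>1 = B\<^sup>\<alpha>\<close>, written so that the axioms are symmetric under
  exchanging \<open>(A, B, C)\<close> with \<open>(B, A, C\<^sup>-\<^sup>1)\<close>.\<close>

locale macdonald_triple = group G for G (structure) +
  fixes \<alpha> :: int and A B C :: 'a
  assumes A: "A \<in> carrier G" and B: "B \<in> carrier G" and C: "C \<in> carrier G"
    and AB: "A \<otimes> B = B \<otimes> A \<otimes> C"
    and AC: "A \<otimes> C = C \<otimes> A [^] \<alpha>"
    and BC: "B \<otimes> inv C = inv C \<otimes> B [^] \<alpha>"
begin

lemma swap_AB: "B \<otimes> A = A \<otimes> B \<otimes> inv C"
  using A B C unfolding AB by (simp add: m_assoc)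

text \<open>Interpreting the locale a second time through this symmetry turns every result about
  \<open>A\<close> into one about \<open>B\<close>.\<close>

lemma swap: "macdonald_triple G \<alpha> B A (inv C)"
proof
  show "A \<otimes> inv (inv C) = inv (inv C) \<otimes> A [^] \<alpha>"
    unfolding inv_inv[OF C] by (rule AC)
qed (fact A B inv_closed[OF C] swap_AB BC)+

lemma A_C_pow: "A [^] (i::int) \<otimes> C [^] (k::nat) = C [^] k \<otimes> A [^] (i * \<alpha> ^ k)"
  by (rule int_pow_conj_pow_rel[OF A C AC])

lemma C_pow_B: "C [^] (k::nat) \<otimes> B [^] (i::int) = B [^] (i * \<alpha> ^ k) \<otimes> C [^] k"
proof -
  have "B [^] i \<otimes> inv C [^] k = inv C [^] k \<otimes> B [^] (i * \<alpha> ^ k)"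
    by (rule int_pow_conj_pow_rel[OF B _ BC]) (use C in simp)
  then have "inv (inv C [^] k) \<otimes> B [^] i = B [^] (i * \<alpha> ^ k) \<otimes> inv (inv C [^] k)"
    by (rule conj_rel_inv[rotated 3]) (use B C in simp_all)
  then show ?thesis
    using C by (simp add: nat_pow_inv)
qed

text \<open>All factors \<open>C\<close> are collected on the left. An \<open>A\<close> that passes
  i of them is raised to the power \<alpha>^i, and i runs from 1 to \<open>k\<close>.\<close>

lemma pow_AC: "(A \<otimes> C) [^] (k::nat) = C [^] k \<otimes> A [^] (\<alpha> * pow_sum \<alpha> k)"
proof (induction k)
  case (Suc k)
  have "(A \<otimes> C) [^] Suc k = C [^] k \<otimes> (A [^] (\<alpha> * pow_sum \<alpha> k) \<otimes> C) \<otimes> A [^] \<alpha>"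
    using A C by (simp add: Suc.IH AC[symmetric]) (simp add: m_assoc AC)
  also have "A [^] (\<alpha> * pow_sum \<alpha> k) \<otimes> C = C \<otimes> A [^] (\<alpha> * pow_sum \<alpha> k * \<alpha>)"
    using A_C_pow[of "\<alpha> * pow_sum \<alpha> k" 1] C by simp
  finally show ?case
    using A C by (simp add: m_assoc int_pow_mult[symmetric] pow_sum_Suc algebra_simps)
qed simp

text \<open>The relation \<open>AB\<close> says that conjugation by \<open>B\<close> takes
  \<open>A\<close> to \<open>A \<otimes> C\<close>, so it takes \<open>A [^] k\<close> to the power
  computed in \<open>pow_AC\<close>.\<close>

lemma A_pow_B: "A [^] (k::nat) \<otimes> B = B \<otimes> C [^] k \<otimes> A [^] (\<alpha> * pow_sum \<alpha> k)"
proof -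
  have "A [^] int k \<otimes> B = B \<otimes> (A \<otimes> C) [^] int k"
    by (rule int_pow_conj_rel) (use A B C AB in \<open>simp_all add: m_assoc\<close>)
  then show ?thesis
    using A B C by (simp add: int_pow_int pow_AC m_assoc)
qed

text \<open>\<open>C\<close> is a word in \<open>A\<close> and \<open>B\<close>; the proof avoids
  inverses by cancelling \<open>B \<otimes> A\<close> on the left.\<close>

lemma C_commute:
  assumes x: "x \<in> carrier G" and xA: "x \<otimes> A = A \<otimes> x" and xB: "x \<otimes> B = B \<otimes> x"
  shows "x \<otimes> C = C \<otimes> x"
proof -
  have "B \<otimes> A \<otimes> (x \<otimes> C) = x \<otimes> (B \<otimes> A \<otimes> C)"
    using A B C x xA xB by (metis m_assoc m_closed)
  also have "\<dots> = A \<otimes> B \<otimes> x"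
    using A B C x xA xB AB by (metis m_assoc m_closed)
  also have "\<dots> = B \<otimes> A \<otimes> (C \<otimes> x)"
    using A B C x AB by (simp add: m_assoc)
  finally show ?thesis
    using A B C x by (metis m_closed l_cancel)
qed

text \<open>Such a power commutes with \<open>A\<close> and \<open>B\<close>, hence with
  \<open>C\<close>, whereas conjugation by \<open>C\<close> raises it to the power \<alpha>.\<close>

lemma A_pow_eq_one_of_commute:
  assumes "A [^] (i::int) \<otimes> B = B \<otimes> A [^] i"
  shows "A [^] (i * (\<alpha> - 1)) = \<one>"
proof -
  have "A [^] i \<otimes> A = A \<otimes> A [^] i"
    using A by (metis add.commute int_pow_1 int_pow_mult)
  then have "C \<otimes> A [^] i = A [^] i \<otimes> C"
    using C_commute[of "A [^] i"] assms A by simp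
  also have "\<dots> = C \<otimes> A [^] (i * \<alpha>)"
    using A_C_pow[of i 1] C by simp
  finally have "A [^] i = A [^] (i * \<alpha>)"
    using A C by (metis int_pow_closed l_cancel)
  then have "A [^] (i * \<alpha> - i) = \<one>"
    using A by (simp add: int_pow_diff)
  then show ?thesis
    by (simp add: algebra_simps)
qed

text \<open>\<open>A [^] i\<close> and \<open>A [^] (\<alpha> * i)\<close> are conjugate under
  \<open>C\<close>, so they are trivial together.\<close>

lemma A_pow_eq_one_cancel_alpha:
  assumes "A [^] (\<alpha> * i) = \<one>"
  shows "A [^] (i::int) = \<one>"
proof -
  have "A [^] i \<otimes> C = C \<otimes> A [^] (\<alpha> * i)"
    using A_C_pow[of i 1] C by (simp add: mult.commute)
  then show ?thesis
    using A C assms by (simp add: r_cancel_one)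
qed

text \<open>Two evaluations of \<open>A B^k C^j\<close> are compared. One writes
  \<open>B^k C^j\<close> as \<open>C^j B\<close> and moves \<open>A\<close> to the right; the other
  first exchanges \<open>A\<close> and \<open>B^k\<close> by the swapped \<open>A_pow_B\<close>.
  \<open>N\<close> is the exponent left over after cancelling.\<close>

lemma B_pow_conj_A_pow:
  assumes k: "int k = \<alpha> ^ j"
  defines "N \<equiv> int k * \<alpha> ^ k - \<alpha> * pow_sum \<alpha> k"
  shows "B [^] N \<otimes> C [^] (j + k) = C [^] (j + k) \<otimes> A [^] (- N)"
proof -
  interpret sw: macdonald_triple G \<alpha> B A "inv C" by (rule swap)
  define S where "S = \<alpha> * pow_sum \<alpha> k"
  have cl [simp]: "A \<in> carrier G" "B \<in> carrier G" "C \<in> carrier G"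
    by (fact A B C)+
  have 1: "A \<otimes> (B [^] k \<otimes> C [^] j) = B [^] k \<otimes> (C [^] (j + k) \<otimes> A [^] S)"
  proof -
    have "A \<otimes> (B [^] k \<otimes> C [^] j) = A \<otimes> (C [^] j \<otimes> B)"
      using C_pow_B[of j 1] k by (metis int_pow_1 int_pow_int mult_1 B)
    also have "\<dots> = C [^] j \<otimes> (A [^] k \<otimes> B)"
      using A_C_pow[of 1 j] k by (simp add: m_assoc[symmetric]) (metis int_pow_int)
    also have "\<dots> = C [^] j \<otimes> B \<otimes> (C [^] k \<otimes> A [^] S)"
      by (simp add: A_pow_B S_def m_assoc)
    also have "C [^] j \<otimes> B = B [^] k \<otimes> C [^] j"
      using C_pow_B[of j 1] k by (metis int_pow_1 int_pow_int mult_1 B)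
    finally show ?thesis
      by (simp add: m_assoc nat_pow_mult[symmetric])
  qed
  have 2: "B [^] k \<otimes> A = A \<otimes> inv (C [^] k) \<otimes> B [^] S"
    using sw.A_pow_B[of k] by (simp add: S_def nat_pow_inv)
  \<comment> \<open>Inserting \<open>A \<otimes> inv A\<close> after \<open>B [^] k\<close> makes
    fact 2 applicable; \<open>inv A\<close> is then carried across
    \<open>C [^] (j + k)\<close>.\<close>
  have "A \<otimes> (B [^] k \<otimes> C [^] j)
      = B [^] k \<otimes> A \<otimes> (inv A \<otimes> C [^] (j + k) \<otimes> A [^] S)"
    unfolding 1 by (simp add: m_assoc inv_solve_left r_inv) (simp add: m_assoc[symmetric])
  also have "inv A \<otimes> C [^] (j + k) = C [^] (j + k) \<otimes> A [^] (- (\<alpha> ^ (j + k)))"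
    using A_C_pow[of "-1" "j + k"] by (simp add: int_pow_neg)
  finally have "A \<otimes> (B [^] k \<otimes> C [^] j)
      = A \<otimes> (inv (C [^] k) \<otimes> (B [^] S \<otimes> (C [^] (j + k) \<otimes> A [^] (S - \<alpha> ^ (j + k)))))"
    unfolding 2 by (simp add: m_assoc int_pow_mult[symmetric])
  then have "B [^] k \<otimes> C [^] j
      = inv (C [^] k) \<otimes> (B [^] S \<otimes> (C [^] (j + k) \<otimes> A [^] (S - \<alpha> ^ (j + k))))"
    by simp
  then have "C [^] k \<otimes> (B [^] k \<otimes> C [^] j) = B [^] S \<otimes> (C [^] (j + k) \<otimes> A [^] (S - \<alpha> ^ (j + k)))"
    by (simp add: inv_solve_left)
  moreover have "C [^] k \<otimes> (B [^] k \<otimes> C [^] j) = B [^] (int k * \<alpha> ^ k) \<otimes> C [^] (j + k)"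
    using C_pow_B[of k "int k"]
    by (simp add: m_assoc[symmetric] int_pow_int) (simp add: m_assoc nat_pow_mult add.commute)
  moreover have "S - \<alpha> ^ (j + k) = - N"
    by (simp add: N_def S_def k power_add)
  ultimately have 3: "B [^] (int k * \<alpha> ^ k) \<otimes> C [^] (j + k) = B [^] S \<otimes> (C [^] (j + k) \<otimes> A [^] (- N))"
    by simp
  have "B [^] (int k * \<alpha> ^ k) = B [^] S \<otimes> B [^] N"
    by (simp add: N_def S_def int_pow_mult[symmetric])
  with 3 have "B [^] S \<otimes> (B [^] N \<otimes> C [^] (j + k)) = B [^] S \<otimes> (C [^] (j + k) \<otimes> A [^] (- N))"
    by (simp add: m_assoc)
  then show ?thesis
    by simp
qed

text \<open>Raising the relation of \<open>B_pow_conj_A_pow\<close> to the power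
  \<open>\<alpha> ^ L\<close> and moving the power of \<open>A\<close> back across
  \<open>C [^] L\<close> gives \<open>A [^] (- N) = B [^] (N * \<alpha> ^ L)\<close>. This element
  commutes with \<open>B\<close>, so \<open>A\<close> is killed by
  \<open>N * (\<alpha> - 1)\<close>, which is \<alpha> times the stated exponent.\<close>

theorem A_pow_eq_one:
  assumes j: "0 < j" and k: "int k = \<alpha> ^ j"
  shows "A [^] (1 - \<alpha> ^ k * (1 - (\<alpha> - 1) * \<alpha> ^ (j - 1))) = \<one>"
proof -
  define N where "N = int k * \<alpha> ^ k - \<alpha> * pow_sum \<alpha> k"
  define L where "L = j + k"
  have cl [simp]: "A \<in> carrier G" "B \<in> carrier G" "C \<in> carrier G"
    by (fact A B C)+
  have 1: "B [^] N \<otimes> C [^] L = C [^] L \<otimes> A [^] (- N)"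
    unfolding N_def L_def by (rule B_pow_conj_A_pow[OF k])
  have "(B [^] N) [^] (\<alpha> ^ L) \<otimes> C [^] L = C [^] L \<otimes> (A [^] (- N)) [^] (\<alpha> ^ L)"
    by (rule int_pow_conj_rel) (use 1 in simp_all)
  also have "\<dots> = A [^] (- N) \<otimes> C [^] L"
    using A_C_pow[of "- N" L] by (simp add: int_pow_pow)
  finally have AB_eq: "A [^] (- N) = B [^] (N * \<alpha> ^ L)"
    by (simp add: int_pow_pow)
  have "A [^] (- N) \<otimes> B = B \<otimes> A [^] (- N)"
    unfolding AB_eq by (metis B add.commute int_pow_1 int_pow_mult)
  then have "A [^] (- N * (\<alpha> - 1)) = \<one>"
    by (rule A_pow_eq_one_of_commute)
  moreover have "- N * (\<alpha> - 1) = - (\<alpha> * (1 - \<alpha> ^ k * (1 - (\<alpha> - 1) * \<alpha> ^ (j - 1))))"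
  proof -
    have "N * (\<alpha> - 1) = \<alpha> ^ j * \<alpha> ^ k * (\<alpha> - 1) - \<alpha> * ((\<alpha> - 1) * pow_sum \<alpha> k)"
      by (simp add: N_def k algebra_simps)
    moreover have "\<alpha> ^ j = \<alpha> * \<alpha> ^ (j - 1)"
      using j by (cases j) auto
    ultimately show ?thesis
      unfolding pow_sum_geometric by (simp add: algebra_simps)
  qed
  ultimately have "A [^] (\<alpha> * (1 - \<alpha> ^ k * (1 - (\<alpha> - 1) * \<alpha> ^ (j - 1)))) = \<one>"
    using A by (simp add: int_pow_neg inv_eq_1_iff)
  then show ?thesis
    by (rule A_pow_eq_one_cancel_alpha)
qed

text \<open>At \<open>\<alpha> = -1\<close> an admissible \<open>j\<close> in
  \<open>A_pow_eq_one\<close> is even, \<open>k\<close> is 1, and the exponent there is 0. A direct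
  computation takes its place: two expressions for \<open>B A B^-1\<close> give
  \<open>A^2 = B^-2\<close>, which commutes with \<open>B\<close>, and \<open>\<alpha> - 1\<close>
  is -2.\<close>

lemma A_pow_four_eq_one:
  assumes "\<alpha> = -1"
  shows "A [^] (4::int) = \<one>"
proof -
  have cl [simp]: "A \<in> carrier G" "B \<in> carrier G" "C \<in> carrier G"
    by (fact A B C)+
  have AC': "A \<otimes> C = C \<otimes> inv A" and CB: "C \<otimes> B = inv B \<otimes> C"
    using AC C_pow_B[of 1 1] assms by (simp_all add: int_pow_neg)
  have 1: "inv A \<otimes> B = B \<otimes> (inv C \<otimes> inv A)"
  proof -
    have "A [^] (-1::int) \<otimes> B = B \<otimes> (A \<otimes> C) [^] (-1::int)"
      by (rule int_pow_conj_rel) (use AB in \<open>simp_all add: m_assoc\<close>)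
    then show ?thesis
      by (simp add: int_pow_neg inv_mult_group)
  qed
  have "inv A \<otimes> C = C \<otimes> A"
    using int_pow_conj_rel[of A C "inv A" "-1"] AC' by (simp add: int_pow_neg)
  then have 2: "inv C \<otimes> inv A = A \<otimes> inv C"
    by (rule conj_rel_inv[rotated 3]) simp_all
  have "A \<otimes> inv B \<otimes> C = A \<otimes> (C \<otimes> B)"
    by (simp add: CB m_assoc)
  also have "\<dots> = C \<otimes> (inv A \<otimes> B)"
    by (simp add: m_assoc[symmetric] AC')
  also have "\<dots> = inv B \<otimes> (C \<otimes> (inv C \<otimes> inv A))"
    unfolding 1 by (simp add: m_assoc[symmetric] CB) (simp add: m_assoc)
  finally have "A \<otimes> inv B \<otimes> C = inv B \<otimes> inv A"
    by (simp add: m_assoc[symmetric])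
  then have "B \<otimes> A \<otimes> inv B \<otimes> C = inv A"
    by (simp add: m_assoc) (simp add: m_assoc[symmetric])
  then have 3: "B \<otimes> A \<otimes> inv B = inv A \<otimes> inv C"
    using inv_solve_right[of "B \<otimes> A \<otimes> inv B" "inv A" C] by simp
  \<comment> \<open>Second expression for the conjugate, starting from \<open>swap_AB\<close>
    instead of from \<open>A \<otimes> inv B \<otimes> C\<close>.\<close>
  have "B \<otimes> A \<otimes> inv B = A \<otimes> (B \<otimes> inv C) \<otimes> inv B"
    using swap_AB by (simp add: m_assoc)
  also have "\<dots> = A \<otimes> inv C \<otimes> inv B \<otimes> inv B"
    using BC assms by (simp add: m_assoc int_pow_neg)
  also have "\<dots> = inv C \<otimes> (inv A \<otimes> inv B \<otimes> inv B)"
    by (simp add: 2[symmetric] m_assoc)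
  also have "B \<otimes> A \<otimes> inv B = inv C \<otimes> A"
    unfolding 3 by (rule conj_rel_inv[symmetric]) (use AC' in simp_all)
  finally have "A = inv A \<otimes> (inv B \<otimes> inv B)"
    by (simp add: m_assoc)
  then have "A \<otimes> A = inv B \<otimes> inv B"
    using inv_solve_left[of A A "inv B \<otimes> inv B"] by simp
  then have "A [^] (2::int) = B [^] (-2::int)"
    using int_pow_mult[of A 1 1] int_pow_mult[of B "-1" "-1"] by (simp add: int_pow_neg)
  then have "A [^] (2::int) \<otimes> B = B \<otimes> A [^] (2::int)"
    by (metis B add.commute int_pow_1 int_pow_mult)
  then have "A [^] (-4::int) = \<one>"
    using A_pow_eq_one_of_commute[of 2] assms by simp
  then show ?thesis
    by (simp add: int_pow_neg)
qed

end

section \<open>Arithmetic of the exponents\<close>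

lemma pow_sum_cong:
  assumes "int q dvd \<alpha> - 1"
  shows "[pow_sum \<alpha> n = int n] (mod int q)"
proof (induction n)
  case (Suc n)
  have "[\<alpha> = 1] (mod int q)"
    using assms by (simp add: cong_iff_dvd_diff)
  then have "[1 + \<alpha> * pow_sum \<alpha> n = 1 + 1 * int n] (mod int q)"
    by (intro cong_add cong_mult Suc.IH cong_refl)
  then show ?case
    by (simp add: pow_sum_Suc)
qed simp

lemma pow_sum_add: "pow_sum \<alpha> (m + n) = pow_sum \<alpha> m + \<alpha> ^ m * pow_sum \<alpha> n"
  by (induction m) (simp_all add: pow_sum_Suc algebra_simps)

lemma pow_sum_mult: "pow_sum \<alpha> (m * n) = pow_sum \<alpha> m * pow_sum (\<alpha> ^ m) n"
  by (induction n) (simp_all add: pow_sum_Suc pow_sum_add algebra_simps)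

text \<open>Second-order expansion of the geometric sum around \<open>\<beta> = 1\<close>, doubled
  so that the binomial coefficient needs no division.\<close>

lemma two_pow_sum_cong_square:
  "(\<beta> - 1)\<^sup>2 dvd 2 * pow_sum \<beta> n - (2 * int n + (\<beta> - 1) * (int n * (int n - 1)))"
proof (induction n)
  case (Suc n)
  then obtain c where c: "2 * pow_sum \<beta> n = 2 * int n + (\<beta> - 1) * (int n * (int n - 1)) + (\<beta> - 1)\<^sup>2 * c"
    by (auto simp: dvd_def algebra_simps)
  have "2 * pow_sum \<beta> (Suc n) = 2 + \<beta> * (2 * pow_sum \<beta> n)"
    by (simp add: pow_sum_Suc)
  then have "2 * pow_sum \<beta> (Suc n) - (2 * int (Suc n) + (\<beta> - 1) * (int (Suc n) * (int (Suc n) - 1)))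
      = (\<beta> - 1)\<^sup>2 * (int n * (int n - 1) + \<beta> * c)"
    unfolding c by (simp add: algebra_simps power2_eq_square)
  then show ?case
    by simp
qed simp

text \<open>For \<open>l = q\<close> the second-order term
  \<open>(\<beta> - 1) q (q - 1) / 2\<close> is a multiple of q^2, as \<open>q\<close> is odd. For
  \<open>l \<noteq> q\<close> the first-order congruences modulo \<open>q\<close> and modulo
  \<open>l\<close> combine by coprimality.\<close>

lemma pow_sum_prime_cong:
  assumes q: "Factorial_Ring.prime q" "odd q" "int q dvd \<beta> - 1" and l: "Factorial_Ring.prime l" "int l dvd \<beta> - 1"
  shows "[pow_sum \<beta> l = int l] (mod int (q * l))"
proof (cases "l = q")
  case True
  obtain v where v: "\<beta> - 1 = int q * v"
    using q by (auto simp: dvd_def)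
  have "(int q)\<^sup>2 dvd (\<beta> - 1)\<^sup>2"
    using q(3) by (simp add: dvd_power_same)
  then have "(int q)\<^sup>2 dvd 2 * pow_sum \<beta> q - (2 * int q + (\<beta> - 1) * (int q * (int q - 1)))"
    using two_pow_sum_cong_square dvd_trans by blast
  moreover have "(int q)\<^sup>2 dvd (\<beta> - 1) * (int q * (int q - 1))"
    unfolding v by (simp add: power2_eq_square)
  ultimately have "(int q)\<^sup>2 dvd 2 * pow_sum \<beta> q - (2 * int q + (\<beta> - 1) * (int q * (int q - 1)))
      + (\<beta> - 1) * (int q * (int q - 1))"
    by (rule dvd_add)
  then have "(int q)\<^sup>2 dvd 2 * (pow_sum \<beta> q - int q)"
    by (simp add: algebra_simps)
  moreover have "coprime ((int q)\<^sup>2) 2"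
    using q(2) by simp
  ultimately have "(int q)\<^sup>2 dvd pow_sum \<beta> q - int q"
    using coprime_dvd_mult_right_iff by blast
  then show ?thesis
    by (simp add: True cong_iff_dvd_diff power2_eq_square)
next
  case False
  then have "coprime (int q) (int l)"
    using q(1) l(1) by (simp add: primes_coprime)
  then show ?thesis
    using coprime_cong_mult[OF pow_sum_cong[OF q(3)] pow_sum_cong[OF l(2)]] by simp
qed

lemma dvd_pow_minus_one:
  fixes \<alpha> :: int
  shows "\<alpha> - 1 dvd \<alpha> ^ k - 1"
  by (metis dvd_triv_left pow_sum_geometric)

text \<open>Adding a prime factor \<open>p\<close> to \<open>k\<close> multiplies the sum by
  \<open>pow_sum (\<alpha> ^ k) p\<close>, which has \<open>p\<close> terms, all 1 modulo
  \<open>p\<close>.\<close>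

lemma dvd_pow_sum:
  assumes "k > 0" and "\<And>l. Factorial_Ring.prime l \<Longrightarrow> l dvd k \<Longrightarrow> int l dvd \<alpha> - 1"
  shows "int k dvd pow_sum \<alpha> k"
  using assms
proof (induction k rule: prime_divisors_induct)
  case (factor p k)
  have "int p dvd pow_sum (\<alpha> ^ k) p"
  proof -
    have "int p dvd \<alpha> ^ k - 1"
      using factor dvd_pow_minus_one dvd_trans by (metis dvd_triv_left)
    then show ?thesis
      using pow_sum_cong[of p "\<alpha> ^ k" p] by (simp add: cong_dvd_iff)
  qed
  moreover have "int k dvd pow_sum \<alpha> k"
    using factor by simp
  ultimately show ?case
    using pow_sum_mult[of \<alpha> k p] by (simp add: mult.commute mult_dvd_mono)
qed (simp_all add: pow_sum_def)

text \<open>The induction of \<open>dvd_pow_sum\<close> with one more factor \<open>q\<close> of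
  precision: every prime contributes itself times a number that is 1 modulo \<open>q\<close>, by
  \<open>pow_sum_prime_cong\<close>, and such numbers are closed under products.\<close>

lemma pow_sum_cong_mult:
  assumes q: "Factorial_Ring.prime q" "odd q" "int q dvd \<alpha> - 1"
    and "k > 0" and "\<And>l. Factorial_Ring.prime l \<Longrightarrow> l dvd k \<Longrightarrow> int l dvd \<alpha> - 1"
  shows "[pow_sum \<alpha> k = int k] (mod int (q * k))"
  using assms(4-5)
proof (induction k rule: prime_divisors_induct)
  case (factor p k)
  obtain x where x: "pow_sum \<alpha> k = int k + int (q * k) * x"
  proof -
    have "[pow_sum \<alpha> k = int k] (mod int (q * k))"
      using factor by simp
    then show ?thesis
      using that by (metis cong_iff_lin cong_sym)
  qed
  have "[pow_sum (\<alpha> ^ k) p = int p] (mod int (q * p))"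
  proof (rule pow_sum_prime_cong[OF q(1,2) _ factor(1)])
    show "int q dvd \<alpha> ^ k - 1"
      using q dvd_pow_minus_one dvd_trans by blast
    show "int p dvd \<alpha> ^ k - 1"
      using factor dvd_pow_minus_one dvd_trans by (metis dvd_triv_left)
  qed
  then obtain y where y: "pow_sum (\<alpha> ^ k) p = int p + int (q * p) * y"
    by (metis cong_iff_lin cong_sym)
  have "pow_sum \<alpha> (p * k) - int (p * k) = int (q * (p * k)) * (x + y + int q * x * y)"
    using pow_sum_mult[of \<alpha> k p] by (simp add: x y mult.commute[of p k] algebra_simps)
  then show ?case
    by (simp add: cong_iff_dvd_diff)
qed (simp_all add: pow_sum_def)

context
  fixes q k :: nat and \<alpha> :: int
  assumes q: "Factorial_Ring.prime q" "int q dvd \<alpha> - 1"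
    and k: "k > 0" "\<And>l. Factorial_Ring.prime l \<Longrightarrow> l dvd k \<Longrightarrow> int l dvd \<alpha> - 1"
begin

lemma dvd_power_minus_one: "int (q * k) dvd \<alpha> ^ k - 1"
  unfolding pow_sum_geometric[symmetric] of_nat_mult
  by (intro mult_dvd_mono q dvd_pow_sum k)

lemma dvd_pow_sum_mult: "int (q * k) dvd pow_sum \<alpha> (q * k)"
proof (rule dvd_pow_sum)
  show "int l dvd \<alpha> - 1" if "Factorial_Ring.prime l" "l dvd q * k" for l
    using that q k(2)[of l] by (metis prime_dvd_mult_iff primes_dvd_imp_eq)
qed (use q k in \<open>simp add: prime_gt_0_nat\<close>)

text \<open>For odd \<open>q\<close> the first case holds by \<open>pow_sum_cong_mult\<close>. For
  \<open>q = 2\<close> the parity of the quotient \<open>s\<close> of the sum by \<open>k\<close>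
  decides. The factor \<alpha> changes the sum only by a multiple of \<open>q * k\<close>.\<close>

lemma alpha_pow_sum_cases:
  "int (q * k) dvd \<alpha> * pow_sum \<alpha> k - int k \<or> int (q * k) dvd \<alpha> * pow_sum \<alpha> k"
proof -
  have 1: "int k dvd pow_sum \<alpha> k"
    by (rule dvd_pow_sum[OF k])
  then obtain s where s: "pow_sum \<alpha> k = int k * s"
    by (auto simp: dvd_def)
  have 2: "int (q * k) dvd (\<alpha> - 1) * pow_sum \<alpha> k"
    unfolding of_nat_mult by (intro mult_dvd_mono q 1)
  show ?thesis
  proof (cases "even q \<and> even s")
    case True
    then have "q = 2"
      using q(1) by (simp add: prime_nat_iff) (use primes_dvd_imp_eq q(1) two_is_prime_nat in blast)
    then show ?thesis
      using True s by (auto simp: mult_dvd_mono)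
  next
    case False
    have "int (q * k) dvd pow_sum \<alpha> k - int k"
    proof (cases "odd q")
      case True
      then show ?thesis
        using pow_sum_cong_mult[OF q(1) _ q(2) k] by (simp add: cong_iff_dvd_diff)
    next
      case even: False
      then have "q = 2"
        using primes_dvd_imp_eq q(1) two_is_prime_nat by blast
      moreover have "2 dvd s - 1"
        using False even by simp
      moreover have "pow_sum \<alpha> k - int k = (s - 1) * int k"
        by (simp add: s algebra_simps)
      ultimately show ?thesis
        by (simp add: mult_dvd_mono)
    qed
    then have "int (q * k) dvd (\<alpha> - 1) * pow_sum \<alpha> k + (pow_sum \<alpha> k - int k)"
      using 2 by (rule dvd_add[rotated])
    then show ?thesis
      by (simp add: algebra_simps)
  qed
qed

end

text \<open>For negative \<open>\<alpha>\<close> this is meaningful only for even \<open>j\<close>, because of \<^const>\<open>nat\<close>.\<close>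

definition macdonald_exponent :: "int \<Rightarrow> nat \<Rightarrow> int" where
  "macdonald_exponent \<alpha> j = 1 - \<alpha> ^ nat (\<alpha> ^ j) * (1 - (\<alpha> - 1) * \<alpha> ^ (j - 1))"

text \<open>Let \<open>t\<close> be the order of \<alpha> modulo a prime \<open>q\<close> that does
  not divide \<alpha> - 1. The exponent with \<open>j = t\<close> forces \<alpha> to be a unit
  modulo \<open>t\<close>. Then \<open>j = 1\<close> and \<open>j = Suc (totient t)\<close> have the
  same outer power of \<alpha> modulo \<open>q\<close>, and comparing them gives
  \<open>t dvd totient t\<close>, hence \<open>t = 1\<close>.\<close>

lemma prime_dvd_macdonald_exponents:
  assumes \<alpha>: "\<alpha> \<ge> 2" and q: "Factorial_Ring.prime q"
    and dvd: "\<And>j. j > 0 \<Longrightarrow> int q dvd macdonald_exponent \<alpha> j"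
  shows "int q dvd \<alpha> - 1"
proof (rule ccontr)
  assume ndvd: "\<not> int q dvd \<alpha> - 1"
  define a where "a = nat \<alpha>"
  have a: "\<alpha> = int a" "a > 0"
    using \<alpha> by (simp_all add: a_def)
  have D: "[\<alpha> ^ (a ^ j) * (1 - (\<alpha> - 1) * \<alpha> ^ (j - 1)) = 1] (mod int q)" if "j > 0" for j
    using dvd[OF that] by (simp add: macdonald_exponent_def a nat_power_eq cong_iff_dvd_diff dvd_diff_commute)
  have cop: "coprime q a"
  proof -
    have "\<not> q dvd a"
    proof
      assume "q dvd a"
      then have "int q dvd \<alpha> ^ (a ^ 1) * (1 - (\<alpha> - 1) * \<alpha> ^ (1 - 1))"
        using a by (intro dvd_mult2) (simp add: dvd_power_le[where m = 1, simplified] dvd_trans[OF _ dvd_power])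
      with D[of 1] have "int q dvd 1"
        using cong_dvd_iff by (metis zero_less_one)
      then show False
        using q by (simp add: prime_nat_iff)
    qed
    then show ?thesis
      using q by (simp add: prime_imp_coprime)
  qed
  define t where "t = ord q a"
  have cong_pow: "[\<alpha> ^ d = \<alpha> ^ e] (mod int q) \<longleftrightarrow> [d = e] (mod t)" for d e
  proof -
    have "[\<alpha> ^ d = \<alpha> ^ e] (mod int q) \<longleftrightarrow> [a ^ d = a ^ e] (mod q)"
      unfolding a by (metis cong_int_iff of_nat_power)
    then show ?thesis
      using order_divides_expdiff[OF cop] by (simp add: t_def)
  qed
  have copz: "coprime (\<alpha> ^ n) (int q)" for n
    using cop a by (simp add: coprime_commute)
  have "t > 0"
    using cop by (simp add: t_def)
  have cop_t: "coprime a t"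
  proof -
    \<comment> \<open>The extra factor \<alpha> turns \<open>\<alpha> ^ (t - 1)\<close> into
      \<open>\<alpha> ^ t\<close>, which is 1 modulo \<open>q\<close>, so the bracket collapses to
      1.\<close>
    have "[\<alpha> * (\<alpha> ^ (a ^ t) * (1 - (\<alpha> - 1) * \<alpha> ^ (t - 1))) = \<alpha> * 1] (mod int q)"
      by (rule cong_scalar_left[OF D[OF \<open>t > 0\<close>]])
    also have "\<alpha> * (\<alpha> ^ (a ^ t) * (1 - (\<alpha> - 1) * \<alpha> ^ (t - 1))) = \<alpha> ^ (a ^ t) * (\<alpha> - (\<alpha> - 1) * \<alpha> ^ t)"
      using power_eq_if[of \<alpha> t] \<open>t > 0\<close> by (simp add: algebra_simps)
    finally have "[\<alpha> ^ (a ^ t) * (\<alpha> - (\<alpha> - 1) * \<alpha> ^ t) = \<alpha>] (mod int q)"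
      by simp
    moreover have "[\<alpha> ^ (a ^ t) * (\<alpha> - (\<alpha> - 1) * \<alpha> ^ t) = \<alpha> ^ (a ^ t) * (\<alpha> - (\<alpha> - 1) * \<alpha> ^ 0)] (mod int q)"
      by (intro cong_scalar_left cong_diff cong_refl) (simp only: cong_pow, simp add: cong_def)
    ultimately have "[\<alpha> ^ (a ^ t) = \<alpha> ^ 1] (mod int q)"
      by (simp add: cong_def)
    then have "[a ^ t = 1] (mod t)"
      by (simp only: cong_pow)
    then have "coprime (a ^ t) t"
      using cong_imp_coprime cong_sym coprime_1_left by blast
    then show ?thesis
      using \<open>t > 0\<close> by (simp add: coprime_power_left_iff)
  qed
  have "[a ^ totient t = 1] (mod t)"
    by (rule euler_theorem) (fact cop_t)
  then have "[a ^ totient t * a = 1 * a] (mod t)"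
    by (rule cong_scalar_right)
  then have "[\<alpha> ^ (a ^ Suc (totient t)) = \<alpha> ^ (a ^ 1)] (mod int q)"
    by (simp only: cong_pow) (simp add: mult.commute)
  then have "[\<alpha> ^ (a ^ Suc (totient t)) * (1 - (\<alpha> - 1) * \<alpha> ^ totient t)
      = \<alpha> ^ (a ^ 1) * (1 - (\<alpha> - 1) * \<alpha> ^ totient t)] (mod int q)"
    by (rule cong_scalar_right)
  then have "[\<alpha> ^ (a ^ 1) * (1 - (\<alpha> - 1) * \<alpha> ^ totient t) = 1] (mod int q)"
    using D[of "Suc (totient t)"] by (simp add: cong_def)
  then have "[\<alpha> ^ a * (1 - (\<alpha> - 1) * \<alpha> ^ totient t) = \<alpha> ^ a * (1 - (\<alpha> - 1))] (mod int q)"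
    using D[of 1] by (simp add: cong_def)
  then have "[1 - (\<alpha> - 1) * \<alpha> ^ totient t = 1 - (\<alpha> - 1)] (mod int q)"
    using copz cong_mult_lcancel by blast
  then have "int q dvd (\<alpha> - 1) * (\<alpha> ^ totient t - 1)"
    by (simp add: cong_iff_dvd_diff algebra_simps dvd_diff_commute)
  then have "int q dvd \<alpha> ^ totient t - 1"
    using ndvd q by (simp add: prime_dvd_mult_iff)
  then have "[\<alpha> ^ totient t = \<alpha> ^ 0] (mod int q)"
    by (simp add: cong_iff_dvd_diff)
  then have "t dvd totient t"
    by (simp only: cong_pow) (simp add: cong_0_iff)
  then have "t \<le> totient t"
    using \<open>t > 0\<close> by (simp add: dvd_imp_le)
  then have "t = 1"
    using totient_less[of t] \<open>t > 0\<close> by (cases "t = 1") auto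
  then have "[\<alpha> ^ 1 = \<alpha> ^ 0] (mod int q)"
    by (simp only: cong_pow) (simp add: cong_def)
  then show False
    using ndvd by (simp add: cong_iff_dvd_diff)
qed

section \<open>The p-adic valuation of the first exponent\<close>

lemma cubic_binomial_cong:
  fixes u :: int
  shows "u ^ 4 dvd 6 * (1 + u) ^ n - (6 + 6 * int n * u + 3 * (int n * (int n - 1)) * u ^ 2
    + int n * (int n - 1) * (int n - 2) * u ^ 3)"
proof (induction n)
  case (Suc n)
  define N where "N = int n"
  from Suc obtain c where "6 * (1 + u) ^ n - (6 + 6 * N * u + 3 * (N * (N - 1)) * u ^ 2
    + N * (N - 1) * (N - 2) * u ^ 3) = u ^ 4 * c"
    unfolding N_def by (rule dvdE)
  then have c: "6 * (1 + u) ^ n = 6 + 6 * N * u + 3 * (N * (N - 1)) * u ^ 2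
    + N * (N - 1) * (N - 2) * u ^ 3 + u ^ 4 * c"
    by simp
  have "6 * (1 + u) ^ Suc n = (1 + u) * (6 * (1 + u) ^ n)"
    by simp
  then have "6 * (1 + u) ^ Suc n - (6 + 6 * (N + 1) * u + 3 * ((N + 1) * N) * u ^ 2
    + (N + 1) * N * (N - 1) * u ^ 3) = u ^ 4 * (N * (N - 1) * (N - 2) + (1 + u) * c)"
    unfolding c by (simp add: algebra_simps eval_nat_numeral)
  then show ?case
    by (simp add: N_def add.commute)
qed simp

text \<open>With \<open>u = \<alpha> - 1\<close> the first exponent is
  \<open>1 - (1 + u)^(1 + u) (1 - u)\<close>, whose expansion begins with u^3 / 2. The factor 6
  clears the denominators of the cubic binomial expansion.\<close>

lemma six_macdonald_exponent_cong:
  assumes "\<alpha> \<ge> 0"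
  shows "(\<alpha> - 1) ^ 4 dvd 6 * macdonald_exponent \<alpha> 1 - 3 * (\<alpha> - 1) ^ 3"
proof -
  define u where "u = \<alpha> - 1"
  have \<alpha>: "\<alpha> = 1 + u" "int (nat \<alpha>) = 1 + u"
    using assms by (simp_all add: u_def)
  obtain c where "6 * (1 + u) ^ nat \<alpha> - (6 + 6 * (1 + u) * u + 3 * ((1 + u) * (1 + u - 1)) * u ^ 2
    + (1 + u) * (1 + u - 1) * (1 + u - 2) * u ^ 3) = u ^ 4 * c"
    using cubic_binomial_cong[of u "nat \<alpha>"] unfolding dvd_def \<alpha>(2) by blast
  then have c: "6 * (1 + u) ^ nat \<alpha> = 6 + 6 * (1 + u) * u + 3 * ((1 + u) * (1 + u - 1)) * u ^ 2
    + (1 + u) * (1 + u - 1) * (1 + u - 2) * u ^ 3 + u ^ 4 * c"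
    by simp
  have "6 * macdonald_exponent \<alpha> 1 - 3 * u ^ 3 = 6 - (6 * (1 + u) ^ nat \<alpha>) * (1 - u) - 3 * u ^ 3"
    by (simp add: macdonald_exponent_def u_def algebra_simps)
  also have "\<dots> = u ^ 4 * (1 + 2 * u - u ^ 2 + u ^ 3 - (1 - u) * c)"
    unfolding c by (simp add: algebra_simps eval_nat_numeral)
  finally show ?thesis
    unfolding u_def by simp
qed

text \<open>Merges the three cases of the theorem into one exponent of \<open>p\<close>; the value 4
  reflects 81 = 3^4.\<close>

definition macdonald_height :: "int \<Rightarrow> nat \<Rightarrow> nat" where
  "macdonald_height \<alpha> p =
     (let m = multiplicity (int p) (\<alpha> - 1) in
      if p = 2 then 3 * m - 1
      else if p = 3 \<and> m = 1 \<and> [(\<alpha> - 1) div 3 = - 1] (mod 3) then 4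
      else 3 * m)"

lemma prime_3: "Factorial_Ring.prime (3::nat)"
  by simp

text \<open>The leading term u^3 / 2 has valuation \<open>3 * m\<close>, or \<open>3 * m - 1\<close>
  for \<open>p = 2\<close>. The error u^4 must not disturb it after multiplication by 6; at
  \<open>p = 3\<close> this means \<open>3 * m + 2 \<le> 4 * m\<close>, whence
  \<open>m > 1\<close>.\<close>

lemma not_dvd_macdonald_exponent_generic:
  assumes "\<alpha> \<ge> 2" and p: "Factorial_Ring.prime p" "int p dvd \<alpha> - 1"
    and m: "m = multiplicity (int p) (\<alpha> - 1)" and "p = 3 \<Longrightarrow> m > 1"
  shows "\<not> int p ^ (if p = 2 then 3 * m else 3 * m + 1) dvd macdonald_exponent \<alpha> 1"
proof
  assume dvd: "int p ^ (if p = 2 then 3 * m else 3 * m + 1) dvd macdonald_exponent \<alpha> 1"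
  have pz: "Factorial_Ring.prime (int p)"
    using p by simp
  have u0: "\<alpha> - 1 \<noteq> 0"
    using assms by simp
  obtain w where w: "\<alpha> - 1 = int p ^ m * w" "\<not> int p dvd w"
    using multiplicity_decompose'[of "\<alpha> - 1" "int p"] u0 pz m by (metis not_prime_unit)
  have "m > 0"
    using p u0 pz by (simp add: m prime_multiplicity_gt_zero_iff)
  \<comment> \<open>\<open>f\<close> is the exponent in \<open>dvd\<close> increased by the
    valuation of 6 at \<open>p\<close>.\<close>
  define f where "f = (if p = 3 then 3 * m + 2 else 3 * m + 1)"
  have "int p ^ f dvd 6 * macdonald_exponent \<alpha> 1"
  proof -
    consider "p = 2" | "p = 3" | "p \<noteq> 2" "p \<noteq> 3" by blast
    then show ?thesis
    proof cases
      case 1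
      then have "2 ^ 1 * 2 ^ (3 * m) dvd 6 * macdonald_exponent \<alpha> 1"
        using dvd by (intro mult_dvd_mono) auto
      then show ?thesis
        using 1 by (simp add: f_def)
    next
      case 2
      then have "3 ^ 1 * 3 ^ (3 * m + 1) dvd 6 * macdonald_exponent \<alpha> 1"
        using dvd by (intro mult_dvd_mono) auto
      then show ?thesis
        using 2 by (simp add: f_def)
    next
      case 3
      then show ?thesis
        using dvd by (simp add: f_def)
    qed
  qed
  moreover have "int p ^ f dvd 6 * macdonald_exponent \<alpha> 1 - 3 * (\<alpha> - 1) ^ 3"
  proof -
    have "int p ^ f dvd int p ^ (m * 4)"
      using \<open>m > 0\<close> assms(5) by (intro le_imp_power_dvd) (auto simp: f_def)
    also have "\<dots> dvd (\<alpha> - 1) ^ 4"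
      by (simp add: w(1) power_mult_distrib power_mult)
    also have "\<dots> dvd 6 * macdonald_exponent \<alpha> 1 - 3 * (\<alpha> - 1) ^ 3"
      using assms(1) by (intro six_macdonald_exponent_cong) simp
    finally show ?thesis .
  qed
  ultimately have "int p ^ f dvd 3 * (\<alpha> - 1) ^ 3"
    by (metis diff_diff_eq2 add_diff_cancel_left' dvd_diff)
  moreover have "3 * (\<alpha> - 1) ^ 3 = int p ^ (3 * m) * (3 * w ^ 3)"
    by (simp add: w(1) power_mult_distrib power_mult mult.commute[of 3 m])
  ultimately have *: "int p ^ f dvd int p ^ (3 * m) * (3 * w ^ 3)"
    by simp
  have "int p dvd w ^ 3"
  proof (cases "p = 3")
    case True
    then have "(3 ^ (3 * m)) * 9 dvd (3 ^ (3 * m)) * (3 * w ^ 3)"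
      using * by (simp add: f_def power_add)
    then have "9 dvd 3 * w ^ 3"
      using dvd_times_left_cancel_iff[of "3 ^ (3 * m) :: int" 9] by simp
    then have "3 dvd w ^ 3"
      by presburger
    then show ?thesis
      using True by simp
  next
    case False
    then have "int p ^ (3 * m) * int p dvd int p ^ (3 * m) * (3 * w ^ 3)"
      using * by (simp add: f_def mult.commute)
    then have "int p dvd 3 * w ^ 3"
      using p(1) by (simp add: prime_gt_0_nat)
    moreover have "\<not> int p dvd 3"
      using False p(1) primes_dvd_imp_eq[of p 3] by (metis int_dvd_int_iff of_nat_numeral prime_3)
    ultimately show ?thesis
      using prime_dvd_multD[OF pz] by blast
  qed
  then show False
    using w(2) prime_dvd_power[OF pz] by blast
qed

section \<open>The prime 3 with \<open>m = 1\<close>: reduction to finitely many residues\<close>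

lemma power_cong_mod_exponent:
  fixes \<alpha> :: int
  assumes "[\<alpha> ^ t = 1] (mod M)"
  shows "[\<alpha> ^ n = (\<alpha> mod M) ^ (n mod t)] (mod M)"
proof -
  have "[(\<alpha> ^ t) ^ (n div t) * \<alpha> ^ (n mod t) = 1 ^ (n div t) * (\<alpha> mod M) ^ (n mod t)] (mod M)"
    by (intro cong_mult cong_pow assms) (simp add: cong_def)
  then show ?thesis
    by (simp flip: power_mult power_add)
qed

text \<open>Periods of \<alpha>: modulo 81 exponents may be reduced modulo 27, and modulo 243 they
  may be reduced modulo 81. Both are instances of \<open>dvd_power_minus_one\<close> with
  \<open>q = 3\<close> and \<open>k\<close> a power of 3.\<close>

lemma power_cong_one_three:
  fixes \<alpha> :: int
  assumes "3 dvd \<alpha> - 1"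
  shows "[\<alpha> ^ 27 = 1] (mod 81)" "[\<alpha> ^ 81 = 1] (mod 243)"
proof -
  have l: "int l dvd \<alpha> - 1" if "Factorial_Ring.prime l" "l dvd 3 ^ n" for l n
    using that assms by (metis of_nat_numeral prime_dvd_power primes_dvd_imp_eq prime_3)
  have "int (3 * 3 ^ n) dvd \<alpha> ^ (3 ^ n) - 1" for n
  proof (rule dvd_power_minus_one)
    show "int l dvd \<alpha> - 1" if "Factorial_Ring.prime l" "l dvd 3 ^ n" for l
      using that by (rule l)
  qed (simp_all add: assms)
  from this[of 3] this[of 4] show "[\<alpha> ^ 27 = 1] (mod 81)" "[\<alpha> ^ 81 = 1] (mod 243)"
    by (simp_all add: cong_iff_dvd_diff)
qed

lemma macdonald_exponent_cong_mod:
  assumes "[\<alpha> ^ t = 1] (mod M)"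
  shows "[macdonald_exponent \<alpha> j
    = 1 - (\<alpha> mod M) ^ (nat (\<alpha> ^ j) mod t) * (1 - (\<alpha> mod M - 1) * (\<alpha> mod M) ^ (j - 1))] (mod M)"
proof -
  have "[\<alpha> = \<alpha> mod M] (mod M)"
    by (simp add: cong_def)
  then show ?thesis
    unfolding macdonald_exponent_def
    by (intro cong_diff cong_mult cong_refl cong_pow power_cong_mod_exponent assms)
qed

text \<open>Since 27 divides 81, the residue \<open>r\<close> of \<alpha> modulo 81 determines the
  base and the reduced exponent alike, which leaves nine numerical checks.\<close>

lemma not_dvd_macdonald_exponent_81:
  assumes "\<alpha> \<ge> 0" "\<alpha> mod 9 = 4"
  shows "\<not> 81 dvd macdonald_exponent \<alpha> 1"
proof
  define r where "r = \<alpha> mod 81"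
  have 3: "3 dvd \<alpha> - 1"
    using assms by presburger
  have e: "nat \<alpha> mod 27 = nat r mod 27"
    using assms(1) by (simp add: r_def nat_mod_distrib mod_mod_cancel)
  have "[macdonald_exponent \<alpha> 1 = 1 - r ^ (nat r mod 27) * (1 - (r - 1))] (mod 81)"
    using macdonald_exponent_cong_mod[OF power_cong_one_three(1)[OF 3], of 1]
    by (simp only: power_one_right e r_def[symmetric] diff_self_eq_0 power_0 mult_1_right)
  moreover assume "81 dvd macdonald_exponent \<alpha> 1"
  ultimately have dvd: "81 dvd 1 - r ^ (nat r mod 27) * (1 - (r - 1))"
    using cong_dvd_iff by blast
  have "r mod 9 = 4" "0 \<le> r" "r < 81"
    using assms(2) by (simp_all add: r_def mod_mod_cancel)
  then have "r = 4 + 9 * (r div 9)" "0 \<le> r div 9" "r div 9 \<le> 8"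
    by presburger+
  then have "r \<in> (\<lambda>k. 4 + 9 * k) ` {0..8}"
    by (metis atLeastAtMost_iff imageI)
  then have "r = 4 \<or> r = 13 \<or> r = 22 \<or> r = 31 \<or> r = 40 \<or> r = 49 \<or> r = 58 \<or> r = 67 \<or> r = 76"
    by (simp add: simp_from_to)
  with dvd show False
    by (elim disjE) simp_all
qed

text \<open>The binomial series of \<open>8 (1 + 3 w)\<^sup>n\<close>, truncated after the term of degree 4. The remaining
  terms vanish modulo 243, and the factor 8 clears the denominators prime to 3.\<close>

definition power_expansion :: "int \<Rightarrow> nat \<Rightarrow> int" where
  "power_expansion w n = 8 + 24 * int n * w + 36 * (int n * (int n - 1)) * w ^ 2
     + 36 * (int n * (int n - 1) * (int n - 2)) * w ^ 3
     + 27 * (int n * (int n - 1) * (int n - 2) * (int n - 3)) * w ^ 4"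

text \<open>In the induction step the truncated series misses its recursion by 81 times a multiple
  of \<open>N * (N - 1) * (N - 2)\<close>, and 3 divides a product of three consecutive
  integers.\<close>

lemma power_expansion_cong: "[8 * (1 + 3 * w) ^ n = power_expansion w n] (mod 243)"
proof (induction n)
  case (Suc n)
  define N where "N = int n"
  have "N mod 3 = 0 \<or> (N - 1) mod 3 = 0 \<or> (N - 2) mod 3 = 0"
    by presburger
  then have "3 dvd N * (N - 1) * (N - 2)"
    by (auto simp: mod_eq_0_iff_dvd)
  then obtain c where c: "N * (N - 1) * (N - 2) = 3 * c" ..
  have "(1 + 3 * w) * power_expansion w n - power_expansion w (Suc n)
      = 81 * (N * (N - 1) * (N - 2)) * (N - 3) * w ^ 5"
    by (simp add: power_expansion_def N_def eval_nat_numeral algebra_simps)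
  also have "\<dots> = 243 * (c * (N - 3) * w ^ 5)"
    unfolding c by simp
  finally have "[(1 + 3 * w) * power_expansion w n = power_expansion w (Suc n)] (mod 243)"
    by (simp add: cong_iff_dvd_diff)
  moreover have "[8 * (1 + 3 * w) ^ Suc n = (1 + 3 * w) * power_expansion w n] (mod 243)"
    using cong_scalar_left[OF Suc.IH, of "1 + 3 * w"] by (simp add: mult.left_commute)
  ultimately show ?case
    by (rule cong_trans[rotated])
qed (simp add: power_expansion_def)

text \<open>With \<open>r = 1 + 3 * w\<close>, the first list consists of the \<open>r\<close>
  congruent to 7 modulo 27, settled by the exponent with \<open>j = 1\<close>. The second holds the
  other residues that are 7 modulo 9, settled by \<open>j = 2\<close>. The polynomial
  \<open>power_expansion\<close> replaces large powers of \<open>r\<close>.\<close>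

lemma power_expansion_residues:
  "\<forall>w\<in>{2, 11, 20, 29, 38, 47, 56, 65, 74}.
    \<not> 243 dvd 8 - power_expansion w (nat (1 + 3 * w) mod 81) * (1 - 3 * w)"
  "\<forall>w\<in>{5, 8, 14, 17, 23, 26, 32, 35, 41, 44, 50, 53, 59, 62, 68, 71, 77, 80}.
    \<not> 243 dvd 8 - power_expansion w (nat ((1 + 3 * w)\<^sup>2) mod 81) * (1 - 3 * w * (1 + 3 * w))"
  by (simp_all only: ball_simps HOL.simp_thms, simp_all only: power_expansion_def, simp_all)

text \<open>Both exponents are needed: the first one vanishes \<open>3\<close>-adically at \<open>\<alpha> = -2\<close>, the second one
  has too high a valuation for \<open>\<alpha> \<equiv> 7\<close> modulo 27.\<close>

lemma not_dvd_macdonald_exponent_243: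
  assumes "\<alpha> \<ge> 0" "\<alpha> mod 9 = 7"
  shows "\<not> 243 dvd macdonald_exponent \<alpha> 1 \<or> \<not> 243 dvd macdonald_exponent \<alpha> 2"
proof (rule ccontr)
  define r where "r = \<alpha> mod 243"
  have 3: "3 dvd \<alpha> - 1"
    using assms by presburger
  have e1: "nat \<alpha> mod 81 = nat r mod 81"
    using assms(1) by (simp add: r_def nat_mod_distrib mod_mod_cancel)
  have "(nat \<alpha>)\<^sup>2 mod 81 = (nat r)\<^sup>2 mod 81"
    using e1 by (metis power_mod)
  then have e2: "nat (\<alpha>\<^sup>2) mod 81 = nat (r\<^sup>2) mod 81"
    using assms(1) by (simp add: r_def nat_power_eq)
  have "[macdonald_exponent \<alpha> 1 = 1 - r ^ (nat r mod 81) * (1 - (r - 1))] (mod 243)"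
    using macdonald_exponent_cong_mod[OF power_cong_one_three(2)[OF 3], of 1]
    by (simp only: power_one_right e1 r_def[symmetric] diff_self_eq_0 power_0 mult_1_right)
  moreover have "[macdonald_exponent \<alpha> 2 = 1 - r ^ (nat (r\<^sup>2) mod 81) * (1 - (r - 1) * r)] (mod 243)"
    using macdonald_exponent_cong_mod[OF power_cong_one_three(2)[OF 3], of 2]
    by (simp only: e2 r_def[symmetric]) simp
  moreover assume "\<not> (\<not> 243 dvd macdonald_exponent \<alpha> 1 \<or> \<not> 243 dvd macdonald_exponent \<alpha> 2)"
  ultimately have d1: "243 dvd 1 - r ^ (nat r mod 81) * (1 - (r - 1))"
    and d2: "243 dvd 1 - r ^ (nat (r\<^sup>2) mod 81) * (1 - (r - 1) * r)"
    using cong_dvd_iff by blast+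
  have "r mod 9 = 7" "0 \<le> r" "r < 243"
    using assms(2) by (simp_all add: r_def mod_mod_cancel)
  then have "r = 1 + 3 * (2 + 3 * (r div 9))" "0 \<le> r div 9" "r div 9 \<le> 26"
    by presburger+
  then obtain w where w: "r = 1 + 3 * w" "w \<in> (\<lambda>k. 2 + 3 * k) ` {0..26}"
    by (metis atLeastAtMost_iff imageI)
  have w_cases: "w \<in> {2, 11, 20, 29, 38, 47, 56, 65, 74}
      \<or> w \<in> {5, 8, 14, 17, 23, 26, 32, 35, 41, 44, 50, 53, 59, 62, 68, 71, 77, 80}"
    using w(2) by (simp add: simp_from_to) blast
  have e: "[8 * (1 - r ^ n * s) = 8 - power_expansion w n * s] (mod 243)" for n s
    using cong_diff[OF cong_refl cong_scalar_right[OF power_expansion_cong[of w n], of s], of 8]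
    by (simp add: w(1) right_diff_distrib mult.assoc)
  have "243 dvd 8 - power_expansion w (nat r mod 81) * (1 - (r - 1))"
    using d1 cong_dvd_iff[OF e] by (meson dvd_mult)
  moreover have "243 dvd 8 - power_expansion w (nat (r\<^sup>2) mod 81) * (1 - (r - 1) * r)"
    using d2 cong_dvd_iff[OF e] by (meson dvd_mult)
  ultimately show False
    using w_cases power_expansion_residues unfolding w(1) by auto
qed

lemma macdonald_height_bound:
  assumes "\<alpha> \<ge> 2" and p: "Factorial_Ring.prime p" "int p dvd \<alpha> - 1"
  obtains j where "j > 0" "\<not> int p ^ Suc (macdonald_height \<alpha> p) dvd macdonald_exponent \<alpha> j"
proof -
  define m where "m = multiplicity (int p) (\<alpha> - 1)"
  have pz: "Factorial_Ring.prime (int p)"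
    using p by simp
  have "m > 0"
    using p assms(1) pz by (simp add: m_def prime_multiplicity_gt_zero_iff)
  show thesis
  proof (cases "p = 3 \<and> m = 1")
    case False
    \<comment> \<open>For \<open>p = 2\<close> the natural-number subtraction in
      \<open>3 * m - 1\<close> is genuine because \<open>m > 0\<close>.\<close>
    then have "Suc (macdonald_height \<alpha> p) = (if p = 2 then 3 * m else 3 * m + 1)"
      using \<open>m > 0\<close> by (auto simp: macdonald_height_def m_def[symmetric] Let_def)
    moreover have "\<not> int p ^ (if p = 2 then 3 * m else 3 * m + 1) dvd macdonald_exponent \<alpha> 1"
      using False \<open>m > 0\<close> by (intro not_dvd_macdonald_exponent_generic assms m_def) auto
    ultimately have "\<not> int p ^ Suc (macdonald_height \<alpha> p) dvd macdonald_exponent \<alpha> 1"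
      by simp
    then show thesis
      by (rule that[OF zero_less_one])
  next
    case True
    then have mult: "multiplicity 3 (\<alpha> - 1) = 1"
      by (auto simp: m_def)
    have "\<not> 3\<^sup>2 dvd \<alpha> - 1"
      using mult assms(1) by (subst power_dvd_iff_le_multiplicity) auto
    moreover have "3 dvd \<alpha> - 1"
      using True p by simp
    \<comment> \<open>Valuation exactly 1 leaves two residues: 4 belongs to Case 1 and 7 to Case
      3.\<close>
    ultimately have "\<alpha> mod 9 = 4 \<or> \<alpha> mod 9 = 7"
      by simp presburger
    then show thesis
    proof
      assume 4: "\<alpha> mod 9 = 4"
      have "((\<alpha> - 1) div 3) mod 3 = 1"
      proof -
        have "\<alpha> - 1 = 3 * (3 * (\<alpha> div 9) + 1)"
          using mult_div_mod_eq[of 9 \<alpha>] unfolding 4 by simp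
        then have "(\<alpha> - 1) div 3 = 3 * (\<alpha> div 9) + 1"
          by (simp only: nonzero_mult_div_cancel_left)
        then show ?thesis
          by simp
      qed
      then have "macdonald_height \<alpha> p = 3"
        using True mult by (simp add: macdonald_height_def cong_def)
      then have e: "int p ^ Suc (macdonald_height \<alpha> p) = 81"
        using True by simp
      show thesis
      proof (rule that[of 1])
        show "\<not> int p ^ Suc (macdonald_height \<alpha> p) dvd macdonald_exponent \<alpha> 1"
          unfolding e by (rule not_dvd_macdonald_exponent_81[OF _ 4]) (use assms(1) in simp)
      qed simp
    next
      assume 7: "\<alpha> mod 9 = 7"
      have "((\<alpha> - 1) div 3) mod 3 = 2"
      proof -
        have "\<alpha> - 1 = 3 * (3 * (\<alpha> div 9) + 2)"
          using mult_div_mod_eq[of 9 \<alpha>] unfolding 7 by simp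
        then have "(\<alpha> - 1) div 3 = 3 * (\<alpha> div 9) + 2"
          by (simp only: nonzero_mult_div_cancel_left)
        then show ?thesis
          by simp
      qed
      then have "macdonald_height \<alpha> p = 4"
        using True mult by (simp add: macdonald_height_def cong_def)
      then have e: "int p ^ Suc (macdonald_height \<alpha> p) = 243"
        using True by simp
      have "\<not> 243 dvd macdonald_exponent \<alpha> 1 \<or> \<not> 243 dvd macdonald_exponent \<alpha> 2"
        by (rule not_dvd_macdonald_exponent_243[OF _ 7]) (use assms(1) in simp)
      then show thesis
      proof
        assume "\<not> 243 dvd macdonald_exponent \<alpha> 1"
        then show thesis
          by (intro that[of 1]) (simp_all only: e, simp)
      next
        assume "\<not> 243 dvd macdonald_exponent \<alpha> 2"
        then show thesis
          by (intro that[of 2]) (simp_all only: e, simp)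
      qed
    qed
  qed
qed

section \<open>Orders of the generators\<close>

text \<open>The power of \<open>p\<close> preserves the valuation of \<alpha> - 1, and the factor 9
  preserves the residue of \<open>(\<alpha> - 1) div 3\<close> modulo 3. This later allows a
  negative \<alpha> to be replaced by a positive number.\<close>

lemma macdonald_height_cong:
  assumes "Factorial_Ring.prime p" and "\<alpha> \<noteq> 1" and "\<beta> \<noteq> 1" and "\<beta> \<noteq> \<alpha>"
    and "9 * int p ^ Suc (multiplicity (int p) (\<alpha> - 1)) dvd \<beta> - \<alpha>"
  shows "macdonald_height \<beta> p = macdonald_height \<alpha> p"
proof -
  obtain c where c: "\<beta> - \<alpha> = 9 * int p ^ Suc (multiplicity (int p) (\<alpha> - 1)) * c"
    using assms(5) by (rule dvdE)
  have unit: "\<not> is_unit (int p)"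
    using assms(1) by (simp add: prime_nat_iff)
  have "Suc (multiplicity (int p) (\<alpha> - 1)) \<le> multiplicity (int p) (\<beta> - \<alpha>)"
    using assms(4,5) unit by (intro multiplicity_geI) (auto dest: dvd_mult_right)
  then have "multiplicity (int p) ((\<alpha> - 1) + (\<beta> - \<alpha>)) = multiplicity (int p) (\<alpha> - 1)"
    using assms(2,4) by (intro multiplicity_sum_lt) auto
  then have "multiplicity (int p) (\<beta> - 1) = multiplicity (int p) (\<alpha> - 1)"
    by simp
  moreover have "((\<beta> - 1) div 3) mod 3 = ((\<alpha> - 1) div 3) mod 3"
  proof -
    define d where "d = int p ^ Suc (multiplicity (int p) (\<alpha> - 1)) * c"
    have "\<beta> - 1 = (\<alpha> - 1) + (d * 3) * 3"
      using c unfolding d_def by linarith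
    moreover have "((\<alpha> - 1) + (d * 3) * 3) div 3 = d * 3 + (\<alpha> - 1) div 3"
      by (rule div_mult_self1) simp
    ultimately have "(\<beta> - 1) div 3 = d * 3 + (\<alpha> - 1) div 3"
      by simp
    then show ?thesis
      by simp
  qed
  ultimately show ?thesis
    by (simp add: macdonald_height_def cong_def Let_def)
qed

context macdonald_triple
begin

lemma ord_dvd_macdonald_exponent:
  assumes "\<alpha> \<ge> 0" "j > 0"
  shows "int (ord A) dvd macdonald_exponent \<alpha> j"
proof -
  have "A [^] macdonald_exponent \<alpha> j = \<one>"
    unfolding macdonald_exponent_def by (rule A_pow_eq_one) (use assms in auto)
  then show ?thesis
    using A by (simp add: int_pow_eq_id)
qed

text \<open>The witness is the gcd of all \<open>macdonald_exponent \<alpha> j\<close>, each of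
  which kills \<open>A\<close> and \<open>B\<close>. Its primes divide \<alpha> - 1 by
  \<open>prime_dvd_macdonald_exponents\<close>, and a single \<open>j\<close> bounds its valuation
  at \<open>p\<close>.\<close>

lemma exponent_pos_case:
  assumes \<alpha>: "\<alpha> \<ge> 2" and p: "Factorial_Ring.prime p" "int p dvd \<alpha> - 1"
  obtains n :: nat where "n > 0" "A [^] n = \<one>" "B [^] n = \<one>"
    "\<And>q. Factorial_Ring.prime q \<Longrightarrow> q dvd n \<Longrightarrow> int q dvd \<alpha> - 1"
    "\<not> p ^ Suc (macdonald_height \<alpha> p) dvd n"
proof -
  interpret sw: macdonald_triple G \<alpha> B A "inv C" by (rule swap)
  define g where "g = Gcd (macdonald_exponent \<alpha> ` {0<..})"
  have g: "g dvd macdonald_exponent \<alpha> j" if "j > 0" for j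
    unfolding g_def by (rule Gcd_dvd) (use that in auto)
  obtain j where j: "j > 0" "\<not> int p ^ Suc (macdonald_height \<alpha> p) dvd macdonald_exponent \<alpha> j"
    using macdonald_height_bound[OF assms] .
  \<comment> \<open>An exponent that some power of \<open>p\<close> fails to divide is nonzero, and
    \<open>g\<close> divides it.\<close>
  have "g \<noteq> 0"
    using g[OF j(1)] j(2) by auto
  moreover have "g \<ge> 0"
    by (simp add: g_def)
  ultimately have ng: "int (nat g) = g" "nat g > 0"
    by auto
  have dvd_g: "int (ord x) dvd g" if "\<And>j. j > 0 \<Longrightarrow> int (ord x) dvd macdonald_exponent \<alpha> j" for x
    unfolding g_def by (rule Gcd_greatest) (use that in auto)
  have "int (ord A) dvd int (nat g)"
    unfolding ng by (intro dvd_g ord_dvd_macdonald_exponent) (use \<alpha> in auto)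
  moreover have "int (ord B) dvd int (nat g)"
    unfolding ng by (intro dvd_g sw.ord_dvd_macdonald_exponent) (use \<alpha> in auto)
  ultimately have ord: "ord A dvd nat g" "ord B dvd nat g"
    by (simp_all only: int_dvd_int_iff)
  show thesis
  proof (rule that[of "nat g"])
    show "A [^] nat g = \<one>" "B [^] nat g = \<one>"
      using A B ord by (simp_all add: pow_eq_id)
    show "nat g > 0"
      by (fact ng)
    show "int q dvd \<alpha> - 1" if "Factorial_Ring.prime q" "q dvd nat g" for q
    proof (rule prime_dvd_macdonald_exponents[OF \<alpha> that(1)])
      show "int q dvd macdonald_exponent \<alpha> j" if "j > 0" for j
        using g[OF that] \<open>q dvd nat g\<close> ng(1) by (metis dvd_trans int_dvd_int_iff)
    qed
    show "\<not> p ^ Suc (macdonald_height \<alpha> p) dvd nat g"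
    proof
      assume "p ^ Suc (macdonald_height \<alpha> p) dvd nat g"
      then have "int (p ^ Suc (macdonald_height \<alpha> p)) dvd g"
        using ng(1) by (metis int_dvd_int_iff)
      then show False
        using j g[OF j(1)] dvd_trans by (metis of_nat_power)
    qed
  qed
qed

text \<open>The positive replacement of \<alpha> is built from these finite orders. The exponent for
  \<open>j = 2\<close> vanishes at \<open>\<alpha> = -1\<close>, which is treated apart; for other
  negative \<alpha> its vanishing would make \<alpha> divide 1.\<close>

lemma finite_ord_neg_case:
  assumes "\<alpha> < 0"
  shows "ord A \<noteq> 0"
proof (cases "\<alpha> = -1")
  case True
  then have "int (ord A) dvd 4"
    using A_pow_four_eq_one A by (simp flip: int_pow_eq_id)
  then show ?thesis
    by (intro notI) simp
next
  case False
  define E where "E = 1 - \<alpha> ^ nat (\<alpha>\<^sup>2) * (1 - (\<alpha> - 1) * \<alpha> ^ (2 - 1))"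
  have "A [^] E = \<one>"
    unfolding E_def by (rule A_pow_eq_one) simp_all
  then have "int (ord A) dvd E"
    using A by (simp add: int_pow_eq_id)
  moreover have "E \<noteq> 0"
  proof
    assume "E = 0"
    then have "\<alpha> ^ nat (\<alpha>\<^sup>2) * (1 - (\<alpha> - 1) * \<alpha> ^ (2 - 1)) = 1"
      by (simp add: E_def)
    moreover have "\<alpha> dvd \<alpha> ^ nat (\<alpha>\<^sup>2)"
      using assms by (intro dvd_power) simp
    ultimately have "\<alpha> dvd 1"
      by (metis dvd_mult2)
    then show False
      using assms False by auto
  qed
  ultimately show ?thesis
    by auto
qed

lemma cong_triple:
  assumes "int (ord A) dvd \<beta> - \<alpha>" "int (ord B) dvd \<beta> - \<alpha>"
  shows "macdonald_triple G \<beta> A B C"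
proof -
  have "A [^] \<beta> = A [^] (\<beta> - \<alpha>) \<otimes> A [^] \<alpha>" "B [^] \<beta> = B [^] (\<beta> - \<alpha>) \<otimes> B [^] \<alpha>"
    using A B by (simp_all add: int_pow_mult[symmetric])
  moreover have "A [^] (\<beta> - \<alpha>) = \<one>" "B [^] (\<beta> - \<alpha>) = \<one>"
    using A B assms by (simp_all add: int_pow_eq_id)
  ultimately have "A [^] \<beta> = A [^] \<alpha>" "B [^] \<beta> = B [^] \<alpha>"
    using A B by simp_all
  then show ?thesis
    using AC BC by unfold_locales (simp_all only: A B C AB)
qed

text \<open>A negative \<open>\<alpha>\<close> is replaced by a positive number congruent to it modulo the orders of
  \<open>A\<close> and \<open>B\<close> and modulo a high power of \<open>p\<close>.\<close>

theorem exponent_exists: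
  assumes \<alpha>: "\<alpha> \<notin> {0, 1, 2}" and p: "Factorial_Ring.prime p" "int p dvd \<alpha> - 1"
  obtains n :: nat where "n > 0" "A [^] n = \<one>" "B [^] n = \<one>"
    "\<And>q. Factorial_Ring.prime q \<Longrightarrow> q dvd n \<Longrightarrow> int q dvd \<alpha> - 1"
    "\<not> p ^ Suc (macdonald_height \<alpha> p) dvd n"
proof (cases "\<alpha> \<ge> 0")
  case True
  then have "\<alpha> \<ge> 2"
    using \<alpha> by auto
  show thesis
    using exponent_pos_case[OF \<open>\<alpha> \<ge> 2\<close> p] that by blast
next
  case False
  interpret sw: macdonald_triple G \<alpha> B A "inv C" by (rule swap)
  define N where "N = ord A * ord B"
  have "N > 0"
    using finite_ord_neg_case sw.finite_ord_neg_case False by (simp add: N_def)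
  define P where "P = int N * (9 * int p ^ Suc (multiplicity (int p) (\<alpha> - 1)))"
  have "P > 0"
    using \<open>N > 0\<close> p(1) by (simp add: P_def prime_gt_0_nat)
  \<comment> \<open>\<open>P \<ge> 1\<close> and \<open>2 - \<alpha> > 0\<close> make \<beta> at
    least 2, while \<beta> stays congruent to \<alpha> modulo \<open>P\<close>.\<close>
  define \<beta> where "\<beta> = \<alpha> + P * (2 - \<alpha>)"
  have "1 * (2 - \<alpha>) \<le> P * (2 - \<alpha>)"
    by (rule mult_right_mono) (use \<open>P > 0\<close> False in auto)
  then have "\<beta> \<ge> 2"
    by (simp add: \<beta>_def)
  have N_dvd: "int N dvd \<beta> - \<alpha>"
    by (simp add: \<beta>_def P_def)
  interpret b: macdonald_triple G \<beta> A B C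
    by (rule cong_triple; rule dvd_trans[OF _ N_dvd]) (simp_all add: N_def)
  have "int p dvd P"
    by (simp add: P_def)
  moreover have "\<beta> - 1 = (\<alpha> - 1) + P * (2 - \<alpha>)"
    by (simp add: \<beta>_def)
  ultimately have p_dvd: "int p dvd \<beta> - 1"
    using p(2) by (metis dvd_add dvd_mult2)
  have height: "macdonald_height \<beta> p = macdonald_height \<alpha> p"
    by (rule macdonald_height_cong[OF p(1)]) (use \<open>\<beta> \<ge> 2\<close> False in \<open>auto simp: \<beta>_def P_def\<close>)
  obtain n where n: "n > 0" "A [^] n = \<one>" "B [^] n = \<one>"
    "\<And>q. Factorial_Ring.prime q \<Longrightarrow> q dvd n \<Longrightarrow> int q dvd \<beta> - 1"
    "\<not> p ^ Suc (macdonald_height \<beta> p) dvd n"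
    using b.exponent_pos_case[OF \<open>\<beta> \<ge> 2\<close> p(1) p_dvd] by blast
  \<comment> \<open>The primes of \<open>n\<close> divide \<beta> - 1. Taking the gcd with
    \<open>N\<close>, which divides \<beta> - \<alpha>, leaves only primes that divide \<alpha> -
    1.\<close>
  show thesis
  proof (rule that[of "gcd n N"])
    show "gcd n N > 0"
      using n by simp
    show "A [^] gcd n N = \<one>" "B [^] gcd n N = \<one>"
      using n(2,3) A B by (auto simp: pow_eq_id N_def)
    show "int q dvd \<alpha> - 1" if "Factorial_Ring.prime q" "q dvd gcd n N" for q
    proof -
      have "int q dvd \<beta> - 1"
        using that n(4) by simp
      moreover have "int q dvd \<beta> - \<alpha>"
        using that N_dvd by (meson dvd_trans gcd_dvd2 int_dvd_int_iff)
      ultimately have "int q dvd (\<beta> - 1) - (\<beta> - \<alpha>)"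
        by (rule dvd_diff)
      then show ?thesis
        by simp
    qed
    show "\<not> p ^ Suc (macdonald_height \<alpha> p) dvd gcd n N"
      using n(5) unfolding height by (meson dvd_trans gcd_dvd1)
  qed
qed

section \<open>Homomorphic images, and the powers of \<open>A\<close> and \<open>C\<close> in a step
  for one prime\<close>

lemma hom_triple:
  assumes "group H" "h \<in> hom G H"
  shows "macdonald_triple H \<alpha> (h A) (h B) (h C)"
proof -
  interpret h: group_hom G H h
    using assms by (simp add: group_hom_def group_hom_axioms_def)
  show ?thesis
  proof
    show "h A \<otimes>\<^bsub>H\<^esub> h B = h B \<otimes>\<^bsub>H\<^esub> h A \<otimes>\<^bsub>H\<^esub> h C"
      using A B C by (simp only: h.hom_mult[symmetric] m_closed AB)
    show "h A \<otimes>\<^bsub>H\<^esub> h C = h C \<otimes>\<^bsub>H\<^esub> h A [^]\<^bsub>H\<^esub> \<alpha>"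
      using A C by (simp only: h.hom_mult[symmetric] h.hom_int_pow[symmetric] int_pow_closed AC)
    show "h B \<otimes>\<^bsub>H\<^esub> inv\<^bsub>H\<^esub> (h C) = inv\<^bsub>H\<^esub> (h C) \<otimes>\<^bsub>H\<^esub> h B [^]\<^bsub>H\<^esub> \<alpha>"
      using B C by (simp only: h.hom_mult[symmetric] h.hom_inv[symmetric] h.hom_int_pow[symmetric]
          int_pow_closed inv_closed BC)
  qed (use A B C in auto)
qed

context
  fixes q k :: nat
  assumes q: "Factorial_Ring.prime q" "int q dvd \<alpha> - 1"
    and k: "k > 0" "\<And>l. Factorial_Ring.prime l \<Longrightarrow> l dvd k \<Longrightarrow> int l dvd \<alpha> - 1"
    and A_pow: "A [^] (q * k) = \<one>"
begin

lemma A_pow_eq_one_of_dvd: "int (q * k) dvd i \<Longrightarrow> A [^] (i::int) = \<one>"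
  using A_pow A by (metis dvd_trans int_dvd_int_iff int_pow_eq_id pow_eq_id)

lemma A_pow_cong: "int (q * k) dvd i - j \<Longrightarrow> A [^] (i::int) = A [^] (j::int)"
  using A_pow_eq_one_of_dvd[of "i - j"] A
  by (metis diff_add_cancel int_pow_closed int_pow_mult l_one)

lemma A_commute_C_pow: "A \<otimes> C [^] k = C [^] k \<otimes> A"
proof -
  have "A [^] (\<alpha> ^ k) = A [^] (1::int)"
    by (rule A_pow_cong) (rule dvd_power_minus_one[OF q k])
  then show ?thesis
    using A_C_pow[of 1 k] A by simp
qed

text \<open>In \<open>A_pow_B\<close> with \<open>q * k\<close> for \<open>k\<close> both powers of
  \<open>A\<close> are trivial, so \<open>B = B \<otimes> C [^] (q * k)\<close> remains.\<close>

lemma C_pow_eq_one: "C [^] (q * k) = \<one>"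
proof -
  have "A [^] (\<alpha> * pow_sum \<alpha> (q * k)) = \<one>"
    by (rule A_pow_eq_one_of_dvd) (intro dvd_mult dvd_pow_sum_mult[OF q k])
  then have "\<one> \<otimes> B = B \<otimes> C [^] (q * k) \<otimes> \<one>"
    using A_pow_B[of "q * k"] A_pow by simp
  then have "B \<otimes> \<one> = B \<otimes> C [^] (q * k)"
    using B C by simp
  then show ?thesis
    using B C by (metis l_cancel nat_pow_closed one_closed)
qed

text \<open>Once \<open>C [^] k\<close> is trivial, conjugation by \<open>B\<close> sends
  \<open>A [^] k\<close> to \<open>A [^] (\<alpha> * pow_sum \<alpha> k)\<close>. By
  \<open>alpha_pow_sum_cases\<close> this is \<open>A [^] k\<close> again, or it is trivial and then
  so is \<open>A [^] k\<close>.\<close>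

lemma A_pow_commute_B:
  assumes "C [^] k = \<one>"
  shows "A [^] k \<otimes> B = B \<otimes> A [^] k"
proof -
  have *: "A [^] k \<otimes> B = B \<otimes> A [^] (\<alpha> * pow_sum \<alpha> k)"
    using A_pow_B[of k] assms A B by simp
  from alpha_pow_sum_cases[OF q k] show ?thesis
  proof
    assume "int (q * k) dvd \<alpha> * pow_sum \<alpha> k - int k"
    then have "A [^] (\<alpha> * pow_sum \<alpha> k) = A [^] int k"
      by (rule A_pow_cong)
    then show ?thesis
      using * by (simp add: int_pow_int)
  next
    assume "int (q * k) dvd \<alpha> * pow_sum \<alpha> k"
    then have "A [^] k \<otimes> B = \<one> \<otimes> B"
      using * A_pow_eq_one_of_dvd B by simp
    then have "A [^] k = \<one>"
      using A B by (metis nat_pow_closed one_closed r_cancel)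
    then show ?thesis
      using B by simp
  qed
qed

end

end

section \<open>Peeling off central elements\<close>

text \<open>\<open>comm\<close> says that the image of \<open>z\<close> in \<open>G Mod N\<close> is
  central, so the cyclic group \<open>S\<close> that it generates is normal, and its order divides
  \<open>q\<close>. The preimage \<open>K\<close> of \<open>S\<close> has order
  \<open>card S * card N\<close>.\<close>

lemma (in group) adjoin_central:
  assumes N: "N \<lhd> G" "finite N" and z: "z \<in> carrier G"
    and q: "Factorial_Ring.prime q" "z [^] q \<in> N"
    and comm: "\<And>g. g \<in> carrier G \<Longrightarrow> N #> (z \<otimes> g) = N #> (g \<otimes> z)"
  obtains K where "K \<lhd> G" "N \<subseteq> K" "z \<in> K" "finite K"
    "\<And>r. Factorial_Ring.prime r \<Longrightarrow> r dvd card K \<Longrightarrow> r dvd card N \<or> r = q"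
proof -
  interpret N: normal N G by (rule N)
  interpret Q: group "G Mod N" by (rule N.factorgroup_is_group)
  define h where "h = (\<lambda>x. N #> x)"
  interpret h: group_hom G "G Mod N" h
    unfolding h_def using N.r_coset_hom_Mod by unfold_locales
  define S where "S = generate (G Mod N) {h z}"
  define K where "K = {x \<in> carrier G. h x \<in> S}"
  have hz: "h z \<in> carrier (G Mod N)"
    using z by simp
  have "subgroup S (G Mod N)"
    unfolding S_def by (rule Q.generate_is_subgroup) (use hz in simp)
  then interpret S: subgroup S "G Mod N" .
  have h_N: "h x = \<one>\<^bsub>G Mod N\<^esub> \<longleftrightarrow> x \<in> N" if "x \<in> carrier G" for x
    using coset_join1[OF _ that N.subgroup_axioms] coset_join2[OF that N.subgroup_axioms]
    by (auto simp: h_def FactGroup_def)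
  have comm_S: "s \<otimes>\<^bsub>G Mod N\<^esub> h g = h g \<otimes>\<^bsub>G Mod N\<^esub> s" if "s \<in> S" "g \<in> carrier G" for s g
  proof -
    have "h z \<otimes>\<^bsub>G Mod N\<^esub> h g = h g \<otimes>\<^bsub>G Mod N\<^esub> h z"
    proof -
      have "h (z \<otimes> g) = h (g \<otimes> z)"
        unfolding h_def by (rule comm[OF that(2)])
      then show ?thesis
        using that(2) z by (simp only: h.hom_mult)
    qed
    moreover obtain i :: int where "s = h z [^]\<^bsub>G Mod N\<^esub> i"
      using \<open>s \<in> S\<close> unfolding S_def Q.generate_pow[OF hz] by blast
    ultimately show ?thesis
      using Q.int_pow_conj_rel[of "h z" "h g" "h z" i] hz that(2) by simp
  qed
  have subK: "subgroup K G"
  proof (rule subgroupI)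
    have "\<one> \<in> K"
      using S.one_closed by (simp only: K_def mem_Collect_eq one_closed h.hom_one)
    then show "K \<noteq> {}"
      by blast
    show "a \<otimes> b \<in> K" if "a \<in> K" "b \<in> K" for a b
      using that S.m_closed by (simp only: K_def mem_Collect_eq m_closed h.hom_mult)
    show "inv a \<in> K" if "a \<in> K" for a
      using that S.m_inv_closed by (simp only: K_def mem_Collect_eq inv_closed h.hom_inv)
  qed (auto simp: K_def)
  have KG: "K \<lhd> G"
    unfolding normal_inv_iff
  proof (intro conjI ballI subK)
    fix x g assume x: "x \<in> carrier G" and g: "g \<in> K"
    have "h (x \<otimes> g) = h (g \<otimes> x)"
      using comm_S[of "h g" x] x g by (simp only: K_def mem_Collect_eq h.hom_mult)
    then have "h (x \<otimes> g \<otimes> inv x) = h (g \<otimes> x \<otimes> inv x)"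
      using x g by (simp only: K_def mem_Collect_eq h.hom_mult m_closed inv_closed)
    also have "\<dots> = h g"
      using x g by (simp add: K_def m_assoc)
    finally show "x \<otimes> g \<otimes> inv x \<in> K"
      using x g by (simp add: K_def)
  qed
  have NK: "N \<subseteq> K"
  proof
    fix x assume x: "x \<in> N"
    then have "x \<in> carrier G"
      using N.subset by blast
    then show "x \<in> K"
      using x h_N[of x] S.one_closed by (simp only: K_def mem_Collect_eq simp_thms)
  qed
  have zK: "z \<in> K"
    using z by (auto simp: K_def S_def intro: generate.incl)
  have hK: "h ` K = S"
  proof
    show "S \<subseteq> h ` K"
    proof
      fix s assume "s \<in> S"
      moreover from this have "s \<in> carrier (G Mod N)"
        by (rule S.mem_carrier)
      then obtain x where "x \<in> carrier G" "s = h x"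
        by (auto simp: FactGroup_def RCOSETS_def h_def)
      ultimately show "s \<in> h ` K"
        by (auto simp: K_def)
    qed
  qed (auto simp: K_def)
  have "h z [^]\<^bsub>G Mod N\<^esub> q = \<one>\<^bsub>G Mod N\<^esub>"
    using q(2) z h_N[of "z [^] q"] by (simp flip: h.hom_nat_pow)
  then have card_S: "card S dvd q"
    using Q.pow_eq_id[OF hz] Q.generate_pow_card[OF hz] by (simp add: S_def)
  then have fin_S: "finite S"
    using q(1) by (metis card.infinite dvd_0_left_iff not_prime_0)
  \<comment> \<open>\<open>K\<close> is covered by the finitely many cosets in \<open>S\<close>,
    each of them a translate of the finite \<open>N\<close>.\<close>
  have "K \<subseteq> \<Union>S"
    using hK rcos_self[OF _ N.subgroup_axioms] by (auto simp: K_def h_def)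
  moreover have "finite s" if "s \<in> S" for s
    using that hK N(2) by (auto simp: h_def r_coset_def)
  ultimately have fin_K: "finite K"
    using fin_S by (meson finite_Union finite_subset)
  interpret GK: group "G\<lparr>carrier := K\<rparr>"
    by (rule subgroup_imp_group[OF subK])
  have "subgroup N (G\<lparr>carrier := K\<rparr>)"
    using subgroup_incl[OF N.subgroup_axioms subK NK] .
  from GK.lagrange[OF this] have "card (rcosets\<^bsub>G\<lparr>carrier := K\<rparr>\<^esub> N) * card N = card K"
    by (simp add: order_def)
  moreover have "rcosets\<^bsub>G\<lparr>carrier := K\<rparr>\<^esub> N = S"
    unfolding hK[symmetric] by (auto simp: RCOSETS_def r_coset_def h_def)
  ultimately have card_K: "card K = card S * card N"
    by simp
  have "r dvd card N \<or> r = q" if "Factorial_Ring.prime r" "r dvd card K" for r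
    using that card_K card_S q(1) by (metis dvd_trans prime_dvd_mult_iff primes_dvd_imp_eq)
  then show thesis
    using that KG NK zK fin_K by blast
qed

lemma (in group) coset_group_hom:
  assumes "N \<lhd> G"
  shows "group_hom G (G Mod N) (\<lambda>x. N #> x)"
proof -
  interpret N: normal N G by (rule assms)
  interpret Q: group "G Mod N" by (rule N.factorgroup_is_group)
  show ?thesis
    using N.r_coset_hom_Mod by unfold_locales
qed

lemma (in group) coset_eq_one_iff:
  assumes "N \<lhd> G" "x \<in> carrier G"
  shows "N #> x = \<one>\<^bsub>G Mod N\<^esub> \<longleftrightarrow> x \<in> N"
  using coset_join1[OF _ assms(2)] coset_join2[OF assms(2)] normal_imp_subgroup[OF assms(1)]
  by (auto simp: FactGroup_def)

section \<open>Groups generated by \<open>A\<close> and \<open>B\<close>, and their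
  quotients\<close>

locale macdonald_generated = macdonald_triple +
  assumes gen: "generate G {A, B} = carrier G"
begin

text \<open>The elements that commute with \<open>x\<close> modulo \<open>N\<close> form a subgroup,
  so it is enough to test the two generators.\<close>

lemma coset_commute:
  assumes N: "N \<lhd> G" and x: "x \<in> carrier G" and g: "g \<in> carrier G"
    and "N #> (x \<otimes> A) = N #> (A \<otimes> x)" "N #> (x \<otimes> B) = N #> (B \<otimes> x)"
  shows "N #> (x \<otimes> g) = N #> (g \<otimes> x)"
proof -
  interpret h: group_hom G "G Mod N" "\<lambda>x. N #> x"
    by (rule coset_group_hom[OF N])
  have gens: "g \<in> carrier G" if "g \<in> generate G {A, B}" for g
    using that gen by simp
  from g have "g \<in> generate G {A, B}"
    by (simp add: gen)
  then have "(N #> x) \<otimes>\<^bsub>G Mod N\<^esub> (N #> g) = (N #> g) \<otimes>\<^bsub>G Mod N\<^esub> (N #> x)"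
  proof (induction rule: generate.induct)
    case one
    have "N #> (x \<otimes> \<one>) = N #> (\<one> \<otimes> x)"
      using x by simp
    then show ?case
      using x by (simp only: h.hom_mult one_closed)
  next
    case (incl g)
    then have "N #> (x \<otimes> g) = N #> (g \<otimes> x)" "g \<in> carrier G"
      using assms(4,5) A B by auto
    then show ?case
      using x by (simp only: h.hom_mult)
  next
    case (inv g)
    then have "N #> (x \<otimes> g) = N #> (g \<otimes> x)" and g: "g \<in> carrier G"
      using assms(4,5) A B by auto
    then have "(N #> x) \<otimes>\<^bsub>G Mod N\<^esub> (N #> g) = (N #> g) \<otimes>\<^bsub>G Mod N\<^esub> (N #> x)"
      using x by (simp only: h.hom_mult)
    then have "inv\<^bsub>G Mod N\<^esub> (N #> g) \<otimes>\<^bsub>G Mod N\<^esub> (N #> x) = (N #> x) \<otimes>\<^bsub>G Mod N\<^esub> inv\<^bsub>G Mod N\<^esub> (N #> g)"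
      using h.H.conj_rel_inv h.hom_closed x g by metis
    then show ?case
      using g by (simp only: h.hom_inv)
  next
    case (eng g1 g2)
    then have c: "N #> g1 \<in> carrier (G Mod N)" "N #> g2 \<in> carrier (G Mod N)" "N #> x \<in> carrier (G Mod N)"
      using gens x by (simp_all only: h.hom_closed)
    have "N #> (g1 \<otimes> g2) = (N #> g1) \<otimes>\<^bsub>G Mod N\<^esub> (N #> g2)"
      using eng gens by (simp only: h.hom_mult)
    then show ?case
      using eng.IH c h.H.m_assoc by metis
  qed
  then show ?thesis
    using x g by (simp only: h.hom_mult)
qed

lemma coset_pow_eq_one:
  assumes "N \<lhd> G" "x \<in> carrier G"
  shows "(N #> x) [^]\<^bsub>G Mod N\<^esub> (n::nat) = \<one>\<^bsub>G Mod N\<^esub> \<longleftrightarrow> x [^] n \<in> N"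
proof -
  interpret h: group_hom G "G Mod N" "\<lambda>x. N #> x"
    by (rule coset_group_hom[OF assms(1)])
  have "N #> (x [^] n) = (N #> x) [^]\<^bsub>G Mod N\<^esub> n"
    using assms(2) by (rule h.hom_nat_pow)
  then show ?thesis
    using coset_eq_one_iff[OF assms(1), of "x [^] n"] assms(2) by simp
qed

lemma coset_triple:
  assumes "N \<lhd> G"
  shows "macdonald_triple (G Mod N) \<alpha> (N #> A) (N #> B) (N #> C)"
proof -
  interpret h: group_hom G "G Mod N" "\<lambda>x. N #> x"
    by (rule coset_group_hom[OF assms])
  show ?thesis
    by (rule hom_triple[OF h.H.group_axioms h.homh])
qed

context
  fixes q k :: nat and N
  assumes q: "Factorial_Ring.prime q" "int q dvd \<alpha> - 1"
    and k: "k > 0" "\<And>l. Factorial_Ring.prime l \<Longrightarrow> l dvd k \<Longrightarrow> int l dvd \<alpha> - 1"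
    and N: "N \<lhd> G"
begin

lemma coset_A_commute_C_pow:
  assumes "A [^] (q * k) \<in> N"
  shows "N #> (C [^] k \<otimes> A) = N #> (A \<otimes> C [^] k)"
proof -
  interpret h: group_hom G "G Mod N" "\<lambda>x. N #> x"
    by (rule coset_group_hom[OF N])
  interpret t: macdonald_triple "G Mod N" \<alpha> "N #> A" "N #> B" "N #> C"
    by (rule coset_triple[OF N])
  have "(N #> A) [^]\<^bsub>G Mod N\<^esub> (q * k) = \<one>\<^bsub>G Mod N\<^esub>"
    using coset_pow_eq_one[OF N A] assms by blast
  from t.A_commute_C_pow[OF q k this] show ?thesis
    using A C by (simp only: h.hom_mult h.hom_nat_pow nat_pow_closed)
qed

lemma C_pow_mem:
  assumes "A [^] (q * k) \<in> N"
  shows "C [^] (q * k) \<in> N"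
proof -
  interpret t: macdonald_triple "G Mod N" \<alpha> "N #> A" "N #> B" "N #> C"
    by (rule coset_triple[OF N])
  have "(N #> A) [^]\<^bsub>G Mod N\<^esub> (q * k) = \<one>\<^bsub>G Mod N\<^esub>"
    using coset_pow_eq_one[OF N A] assms by blast
  from t.C_pow_eq_one[OF q k this] show ?thesis
    using coset_pow_eq_one[OF N C] by blast
qed

lemma coset_A_pow_commute_B:
  assumes "A [^] (q * k) \<in> N" "C [^] k \<in> N"
  shows "N #> (A [^] k \<otimes> B) = N #> (B \<otimes> A [^] k)"
proof -
  interpret h: group_hom G "G Mod N" "\<lambda>x. N #> x"
    by (rule coset_group_hom[OF N])
  interpret t: macdonald_triple "G Mod N" \<alpha> "N #> A" "N #> B" "N #> C"
    by (rule coset_triple[OF N])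
  have "(N #> A) [^]\<^bsub>G Mod N\<^esub> (q * k) = \<one>\<^bsub>G Mod N\<^esub>" "(N #> C) [^]\<^bsub>G Mod N\<^esub> k = \<one>\<^bsub>G Mod N\<^esub>"
    using coset_pow_eq_one[OF N] A C assms by blast+
  from t.A_pow_commute_B[OF q k this] show ?thesis
    using A B by (simp only: h.hom_mult h.hom_nat_pow nat_pow_closed)
qed

end

lemma swap_generated: "macdonald_generated G \<alpha> B A (inv C)"
  by (intro macdonald_generated.intro swap macdonald_generated_axioms.intro)
    (simp add: gen insert_commute)

text \<open>The swapped triple has \<open>inv C\<close> in the place of \<open>C\<close>; this
  returns from powers of \<open>inv C\<close> to powers of \<open>C\<close>.\<close>

lemma coset_inv_commute:
  assumes N: "N \<lhd> G" and x: "x \<in> carrier G" and y: "y \<in> carrier G"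
    and "N #> (inv x \<otimes> y) = N #> (y \<otimes> inv x)"
  shows "N #> (x \<otimes> y) = N #> (y \<otimes> x)"
proof -
  interpret h: group_hom G "G Mod N" "\<lambda>x. N #> x"
    by (rule coset_group_hom[OF N])
  have c: "N #> inv x \<in> carrier (G Mod N)" "N #> y \<in> carrier (G Mod N)"
    using x y by (simp_all only: h.hom_closed inv_closed)
  have "(N #> y) \<otimes>\<^bsub>G Mod N\<^esub> (N #> inv x) = (N #> inv x) \<otimes>\<^bsub>G Mod N\<^esub> (N #> y)"
    using assms(4) x y by (simp only: h.hom_mult inv_closed)
  from h.H.conj_rel_inv[OF c(2,1,2) this]
  have "(N #> inv (inv x)) \<otimes>\<^bsub>G Mod N\<^esub> (N #> y) = (N #> y) \<otimes>\<^bsub>G Mod N\<^esub> (N #> inv (inv x))"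
    using x by (simp only: h.hom_inv inv_closed)
  then show ?thesis
    using x y by (simp only: h.hom_mult inv_inv)
qed

text \<open>\<open>C [^] k\<close>, \<open>A [^] k\<close> and \<open>B [^] k\<close> are adjoined
  in this order by \<open>adjoin_central\<close>. The order matters: the last two are shown to be
  central modulo a subgroup that already contains \<open>C [^] k\<close>.\<close>

lemma normal_extension_step:
  assumes N: "N \<lhd> G" "finite N"
    and q: "Factorial_Ring.prime q" "int q dvd \<alpha> - 1"
    and k: "k > 0" "\<And>l. Factorial_Ring.prime l \<Longrightarrow> l dvd k \<Longrightarrow> int l dvd \<alpha> - 1"
    and pow: "A [^] (q * k) \<in> N" "B [^] (q * k) \<in> N"
  obtains K where "K \<lhd> G" "A [^] k \<in> K" "B [^] k \<in> K" "finite K"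
    "\<And>r. Factorial_Ring.prime r \<Longrightarrow> r dvd card K \<Longrightarrow> r dvd card N \<or> r = q"
proof -
  interpret sw: macdonald_generated G \<alpha> B A "inv C"
    by (rule swap_generated)
  have Ck: "C [^] k \<in> carrier G" and Ak: "A [^] k \<in> carrier G" and Bk: "B [^] k \<in> carrier G"
    using A B C by simp_all
  have powpow: "(x [^] k) [^] q = x [^] (q * k)" if "x \<in> carrier G" for x
    using that by (simp add: nat_pow_pow mult.commute)
  have CB: "N #> (C [^] k \<otimes> B) = N #> (B \<otimes> C [^] k)"
    using sw.coset_A_commute_C_pow[OF q k N(1) pow(2)] C
    by (intro coset_inv_commute[OF N(1) Ck B]) (simp only: nat_pow_inv)
  have "N #> (C [^] k \<otimes> g) = N #> (g \<otimes> C [^] k)" if "g \<in> carrier G" for g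
    by (rule coset_commute[OF N(1) Ck that coset_A_commute_C_pow[OF q k N(1) pow(1)] CB])
  moreover have "(C [^] k) [^] q \<in> N"
    unfolding powpow[OF C] by (rule C_pow_mem[OF q k N(1) pow(1)])
  ultimately obtain K1 where K1: "K1 \<lhd> G" "N \<subseteq> K1" "C [^] k \<in> K1" "finite K1"
      "\<And>r. Factorial_Ring.prime r \<Longrightarrow> r dvd card K1 \<Longrightarrow> r dvd card N \<or> r = q"
    using adjoin_central[OF N Ck q(1)] by blast
  have pow1: "A [^] (q * k) \<in> K1" "B [^] (q * k) \<in> K1"
    using pow K1(2) by blast+
  have "A [^] k \<otimes> A = A \<otimes> A [^] k" "B [^] k \<otimes> B = B \<otimes> B [^] k"
    using nat_pow_Suc2[OF A, of k] nat_pow_Suc2[OF B, of k] by simp_all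
  then have self: "M #> (A [^] k \<otimes> A) = M #> (A \<otimes> A [^] k)" "M #> (B [^] k \<otimes> B) = M #> (B \<otimes> B [^] k)" for M
    by simp_all
  have "K1 #> (A [^] k \<otimes> g) = K1 #> (g \<otimes> A [^] k)" if "g \<in> carrier G" for g
    by (rule coset_commute[OF K1(1) Ak that self(1) coset_A_pow_commute_B[OF q k K1(1) pow1(1) K1(3)]])
  moreover have "(A [^] k) [^] q \<in> K1"
    unfolding powpow[OF A] by (rule pow1(1))
  ultimately obtain K2 where K2: "K2 \<lhd> G" "K1 \<subseteq> K2" "A [^] k \<in> K2" "finite K2"
      "\<And>r. Factorial_Ring.prime r \<Longrightarrow> r dvd card K2 \<Longrightarrow> r dvd card K1 \<or> r = q"
    using adjoin_central[OF K1(1,4) Ak q(1)] by blast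
  \<comment> \<open>The swapped triple asks for the power of \<open>inv C\<close> in the
    subgroup.\<close>
  have pow2: "B [^] (q * k) \<in> K2" and C2: "inv C [^] k \<in> K2"
    using pow1 K1(3) K2(2) normal_imp_subgroup[OF K2(1)] C
    by (auto simp: nat_pow_inv intro: subgroup.m_inv_closed)
  have "K2 #> (B [^] k \<otimes> g) = K2 #> (g \<otimes> B [^] k)" if "g \<in> carrier G" for g
    by (rule coset_commute[OF K2(1) Bk that sw.coset_A_pow_commute_B[OF q k K2(1) pow2 C2] self(2)])
  moreover have "(B [^] k) [^] q \<in> K2"
    unfolding powpow[OF B] by (rule pow2)
  ultimately obtain K where K: "K \<lhd> G" "K2 \<subseteq> K" "B [^] k \<in> K" "finite K"
      "\<And>r. Factorial_Ring.prime r \<Longrightarrow> r dvd card K \<Longrightarrow> r dvd card K2 \<or> r = q"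
    using adjoin_central[OF K2(1,4) Bk q(1)] by blast
  show thesis
  proof (rule that[of K])
    show "A [^] k \<in> K"
      using K(2) K2(3) by blast
    show "r dvd card N \<or> r = q" if r: "Factorial_Ring.prime r" "r dvd card K" for r
      using K(5)[OF r] K2(5)[OF r(1)] K1(5)[OF r(1)] by blast
  qed (fact K)+
qed

text \<open>Induction over the prime factors of \<open>d\<close>: one step with \<open>d * k\<close>
  in the place of \<open>k\<close> removes a prime \<open>p\<close>, and the induction hypothesis
  then starts from the enlarged normal subgroup.\<close>

lemma normal_extension:
  assumes "N \<lhd> G" "finite N" "d > 0" "k > 0"
    and "\<And>l. Factorial_Ring.prime l \<Longrightarrow> l dvd d * k \<Longrightarrow> int l dvd \<alpha> - 1"
    and "A [^] (d * k) \<in> N" "B [^] (d * k) \<in> N"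
  shows "\<exists>K. K \<lhd> G \<and> A [^] k \<in> K \<and> B [^] k \<in> K \<and> finite K
    \<and> (\<forall>r. Factorial_Ring.prime r \<longrightarrow> r dvd card K \<longrightarrow> r dvd card N \<or> r dvd d)"
  using assms
proof (induction d arbitrary: N rule: prime_divisors_induct)
  case (unit d)
  then have "d = 1"
    by simp
  then show ?case
    using unit.prems(1,2,6,7) by (intro exI[of _ N]) simp
next
  case zero
  show ?case
    using zero.prems(3) by blast
next
  case (factor p d)
  have p: "int p dvd \<alpha> - 1"
    by (rule factor.prems(5)[OF factor.hyps(1)]) simp
  have dk: "d * k > 0" and d: "d > 0"
    using factor.prems(3,4) by simp_all
  have l: "int l dvd \<alpha> - 1" if "Factorial_Ring.prime l" "l dvd d * k" for l
    by (rule factor.prems(5)[OF that(1)]) (use that(2) in \<open>simp add: mult.assoc\<close>)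
  obtain K where K: "K \<lhd> G" "A [^] (d * k) \<in> K" "B [^] (d * k) \<in> K" "finite K"
      "\<And>r. Factorial_Ring.prime r \<Longrightarrow> r dvd card K \<Longrightarrow> r dvd card N \<or> r = p"
    using normal_extension_step[OF factor.prems(1,2) factor.hyps(1) p dk l]
      factor.prems(6,7)[unfolded mult.assoc[of p d k]] by blast
  obtain L where L: "L \<lhd> G" "A [^] k \<in> L" "B [^] k \<in> L" "finite L"
      "\<And>r. Factorial_Ring.prime r \<Longrightarrow> r dvd card L \<Longrightarrow> r dvd card K \<or> r dvd d"
    using factor.IH[OF K(1,4) d factor.prems(4) l K(2,3)] by blast
  have "r dvd card N \<or> r dvd p * d" if "Factorial_Ring.prime r" "r dvd card L" for r
    using L(5)[OF that] K(5)[OF that(1)] by (metis dvd_mult dvd_triv_left)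
  with L show ?case
    by blast
qed

lemma normal_eq_carrier:
  assumes "K \<lhd> G" "A \<in> K" "B \<in> K"
  shows "K = carrier G"
proof
  have K: "subgroup K G"
    using assms(1) by (rule normal_imp_subgroup)
  then show "K \<subseteq> carrier G"
    by (rule subgroup.subset)
  show "carrier G \<subseteq> K"
    unfolding gen[symmetric] by (rule generate_subgroup_incl[OF _ K]) (use assms in simp)
qed

text \<open>For \<open>N\<close> trivial, \<open>d = n\<close> and \<open>k = 1\<close>, the normal
  subgroup obtained contains \<open>A\<close> and \<open>B\<close> and is therefore the whole
  group.\<close>

theorem finite_and_prime_dvd_order:
  assumes "n > 0" "A [^] n = \<one>" "B [^] n = \<one>"
    and "\<And>q. Factorial_Ring.prime q \<Longrightarrow> q dvd n \<Longrightarrow> int q dvd \<alpha> - 1"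
  shows "finite (carrier G)" "\<And>r. Factorial_Ring.prime r \<Longrightarrow> r dvd order G \<Longrightarrow> r dvd n"
proof -
  have "\<exists>K. K \<lhd> G \<and> A [^] (1::nat) \<in> K \<and> B [^] (1::nat) \<in> K \<and> finite K
      \<and> (\<forall>r. Factorial_Ring.prime r \<longrightarrow> r dvd card K \<longrightarrow> r dvd card {\<one>} \<or> r dvd n)"
    by (rule normal_extension[OF one_is_normal]) (use assms in simp_all)
  then obtain K where K: "K \<lhd> G" "A \<in> K" "B \<in> K" "finite K"
    and prime: "\<And>r. Factorial_Ring.prime r \<Longrightarrow> r dvd card K \<Longrightarrow> r = 1 \<or> r dvd n"
    using A B by auto
  have carr: "carrier G = K"
    using normal_eq_carrier[OF K(1-3)] by simp
  show "finite (carrier G)"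
    unfolding carr by (rule K(4))
  show "r dvd n" if "Factorial_Ring.prime r" "r dvd order G" for r
    using prime[of r] that not_prime_1 unfolding order_def carr by blast
qed

end

section \<open>Presented groups and the Sylow subgroup\<close>

lemma word_class_append:
  "word_class R (u @ v) = word_class R u \<otimes>\<^bsub>presented_group R\<^esub> word_class R v"
  by (simp add: mult_presented_group)

lemma word_class_closed [simp]: "word_class R w \<in> carrier (presented_group R)"
  by (simp add: carrier_presented_group)

lemma word_class_inv: "word_class R (word_inv w) = inv\<^bsub>presented_group R\<^esub> word_class R w"
proof -
  interpret group "presented_group R" by (rule group_presented_group)
  have "word_class R (word_inv w) \<otimes>\<^bsub>presented_group R\<^esub> word_class R w = \<one>\<^bsub>presented_group R\<^esub>"
    by (simp add: mult_presented_group one_presented_group word_class_eq_iff word_equiv_inv_left)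
  then show ?thesis
    using inv_equality by simp
qed

lemma word_class_concat_replicate:
  "word_class R (concat (replicate n w)) = word_class R w [^]\<^bsub>presented_group R\<^esub> n"
proof -
  interpret group "presented_group R" by (rule group_presented_group)
  show ?thesis
  proof (induction n)
    case (Suc n)
    then show ?case
      using nat_pow_Suc2[OF word_class_closed[of R w], of n] by (simp add: word_class_append)
  qed (simp add: one_presented_group)
qed

lemma word_class_pow: "word_class R (word_pow w k) = word_class R w [^]\<^bsub>presented_group R\<^esub> k"
proof -
  interpret group "presented_group R" by (rule group_presented_group)
  show ?thesis
    by (simp add: word_pow_def int_pow_def2 word_class_concat_replicate word_class_inv nat_pow_inv del: pow_nat)
qed

lemma word_class_conj:
  "word_class R (word_conj v u) =
    inv\<^bsub>presented_group R\<^esub> word_class R u \<otimes>\<^bsub>presented_group R\<^esub> word_class R v \<otimes>\<^bsub>presented_group R\<^esub> word_class R u"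
proof -
  interpret group "presented_group R" by (rule group_presented_group)
  show ?thesis
    by (simp add: word_conj_def word_class_append word_class_inv m_assoc)
qed

lemma word_class_comm:
  "word_class R (word_comm u v) =
    inv\<^bsub>presented_group R\<^esub> word_class R u \<otimes>\<^bsub>presented_group R\<^esub> inv\<^bsub>presented_group R\<^esub> word_class R v
      \<otimes>\<^bsub>presented_group R\<^esub> word_class R u \<otimes>\<^bsub>presented_group R\<^esub> word_class R v"
proof -
  interpret group "presented_group R" by (rule group_presented_group)
  show ?thesis
    by (simp add: word_comm_def word_class_append word_class_inv m_assoc)
qed

lemma word_class_Cons:
  "word_class R ((g, b) # w) = (if b then word_class R (gen g)
     else inv\<^bsub>presented_group R\<^esub> word_class R (gen g)) \<otimes>\<^bsub>presented_group R\<^esub> word_class R w"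
  using word_class_append[of R "[(g, b)]" w] word_class_inv[of R "gen g"]
  by (simp add: gen_def word_inv_def)

text \<open>Turns homomorphisms obtained from the universal property into explicit formulas on
  classes of words.\<close>

lemma word_eval_word_class:
  "word_eval (presented_group R) (\<lambda>g. word_class R (gen g)) w = word_class R w"
proof (induction w)
  case Nil
  then show ?case
    by (simp add: word_eval_def one_presented_group)
next
  case (Cons l w)
  then show ?case
    by (cases l) (simp add: word_eval_def word_class_Cons)
qed

lemma (in group_hom) word_eval_hom:
  assumes "\<And>g. f g \<in> carrier G"
  shows "word_eval H (\<lambda>g. h (f g)) w = h (word_eval G f w)"
proof (induction w)
  case (Cons l w)
  then show ?case
    using G.word_eval_closed[of f w, OF assms] assms by (cases l) (simp add: word_eval_def)
qed (simp add: word_eval_def)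

lemma generate_presented_group:
  "generate (presented_group R) (range (\<lambda>g. word_class R (gen g))) = carrier (presented_group R)"
proof -
  interpret group "presented_group R" by (rule group_presented_group)
  let ?S = "range (\<lambda>g. word_class R (gen g))"
  have "word_class R w \<in> generate (presented_group R) ?S" for w
  proof (induction w)
    case Nil
    then show ?case
      using generate.one[of "presented_group R" ?S] by (simp add: one_presented_group)
  next
    case (Cons l w)
    obtain g b where l: "l = (g, b)"
      by (cases l)
    have "(if b then word_class R (gen g) else inv\<^bsub>presented_group R\<^esub> word_class R (gen g))
        \<in> generate (presented_group R) ?S"
      by (auto intro: generate.incl generate.inv)
    from generate.eng[OF this Cons.IH] show ?case
      by (simp add: l word_class_Cons)
  qed
  moreover have "generate (presented_group R) ?S \<subseteq> carrier (presented_group R)"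
    by (rule generate_incl) auto
  ultimately show ?thesis
    by (auto simp: carrier_presented_group)
qed

text \<open>Allowing any \<open>R\<close> that contains the Macdonald relations covers the Macdonald
  group and the group with the two additional relations at once.\<close>

lemma macdonald_generated_presented_group:
  assumes "macdonald_rels \<alpha> \<subseteq> R"
  shows "macdonald_generated (presented_group R) \<alpha> (word_class R (gen Gen_x)) (word_class R (gen Gen_y))
    (word_class R (word_comm (gen Gen_x) (gen Gen_y)))"
proof -
  interpret group "presented_group R" by (rule group_presented_group)
  define A where "A = word_class R (gen Gen_x)"
  define B where "B = word_class R (gen Gen_y)"
  define C where "C = word_class R (word_comm (gen Gen_x) (gen Gen_y))"
  have [simp]: "A \<in> carrier (presented_group R)" "B \<in> carrier (presented_group R)" "C \<in> carrier (presented_group R)"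
    by (simp_all add: A_def B_def C_def)
  have C: "C = inv\<^bsub>presented_group R\<^esub> A \<otimes>\<^bsub>presented_group R\<^esub> inv\<^bsub>presented_group R\<^esub> B
      \<otimes>\<^bsub>presented_group R\<^esub> A \<otimes>\<^bsub>presented_group R\<^esub> B"
    unfolding C_def word_class_comm A_def B_def ..
  \<comment> \<open>\<open>[y, x]\<close> is the inverse of \<open>[x, y]\<close>, which brings the
    second relation into the form of the locale axiom.\<close>
  have D: "word_class R (word_comm (gen Gen_y) (gen Gen_x)) = inv\<^bsub>presented_group R\<^esub> C"
    unfolding C word_class_comm A_def B_def by (simp add: inv_mult_group m_assoc)
  have rel: "word_class R u = word_class R v" if "(u, v) \<in> macdonald_rels \<alpha>" for u v
    using that assms by (auto simp: word_class_eq_iff intro: word_equiv.rel)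
  have "inv\<^bsub>presented_group R\<^esub> C \<otimes>\<^bsub>presented_group R\<^esub> A \<otimes>\<^bsub>presented_group R\<^esub> C = A [^]\<^bsub>presented_group R\<^esub> \<alpha>"
    using rel[of "word_conj (gen Gen_x) (word_comm (gen Gen_x) (gen Gen_y))" "word_pow (gen Gen_x) \<alpha>"]
    by (simp add: macdonald_rels_def word_class_conj word_class_pow A_def C_def)
  then have AC: "A \<otimes>\<^bsub>presented_group R\<^esub> C = C \<otimes>\<^bsub>presented_group R\<^esub> A [^]\<^bsub>presented_group R\<^esub> \<alpha>"
    by (metis \<open>A \<in> carrier (presented_group R)\<close> \<open>C \<in> carrier (presented_group R)\<close> inv_solve_left' int_pow_closed inv_closed m_assoc m_closed)
  have "inv\<^bsub>presented_group R\<^esub> (inv\<^bsub>presented_group R\<^esub> C) \<otimes>\<^bsub>presented_group R\<^esub> B \<otimes>\<^bsub>presented_group R\<^esub> inv\<^bsub>presented_group R\<^esub> C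
      = B [^]\<^bsub>presented_group R\<^esub> \<alpha>"
    using rel[of "word_conj (gen Gen_y) (word_comm (gen Gen_y) (gen Gen_x))" "word_pow (gen Gen_y) \<alpha>"]
    unfolding word_class_conj word_class_pow D by (simp add: macdonald_rels_def B_def)
  then have BC: "B \<otimes>\<^bsub>presented_group R\<^esub> inv\<^bsub>presented_group R\<^esub> C
      = inv\<^bsub>presented_group R\<^esub> C \<otimes>\<^bsub>presented_group R\<^esub> B [^]\<^bsub>presented_group R\<^esub> \<alpha>"
    by (metis \<open>B \<in> carrier (presented_group R)\<close> \<open>C \<in> carrier (presented_group R)\<close> inv_solve_left' int_pow_closed inv_closed m_assoc m_closed)
  have "range (\<lambda>g. word_class R (gen g)) = {A, B}"
    unfolding A_def B_def by (auto simp: image_iff) (metis two_gens.exhaust)+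
  then have gen: "generate (presented_group R) {A, B} = carrier (presented_group R)"
    using generate_presented_group by metis
  have AB: "A \<otimes>\<^bsub>presented_group R\<^esub> B = B \<otimes>\<^bsub>presented_group R\<^esub> A \<otimes>\<^bsub>presented_group R\<^esub> C"
    unfolding C by (simp add: m_assoc) (simp add: m_assoc[symmetric])
  show ?thesis
    unfolding A_def[symmetric] B_def[symmetric] C_def[symmetric]
    by unfold_locales (fact AB AC BC gen | simp)+
qed

lemma presented_group_hom_of_subset:
  assumes "R \<subseteq> R'"
  obtains h where "h \<in> hom (presented_group R) (presented_group R')" "\<And>w. h (word_class R w) = word_class R' w"
proof -
  interpret P: group "presented_group R'" by (rule group_presented_group)
  have "\<exists>h\<in>hom (presented_group R) (presented_group R').
      \<forall>w. h (word_class R w) = word_eval (presented_group R') (\<lambda>g. word_class R' (gen g)) w"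
    by (rule P.presented_group_universal)
      (use assms in \<open>auto simp: word_eval_word_class word_class_eq_iff intro: word_equiv.rel\<close>)
  then show thesis
    using that by (auto simp: word_eval_word_class)
qed

lemma (in group) ord_dvd_card_subgroup:
  assumes "subgroup H G" "x \<in> H"
  shows "ord x dvd card H"
proof -
  interpret H: group "G\<lparr>carrier := H\<rparr>"
    by (rule subgroup_imp_group[OF assms(1)])
  have "x [^]\<^bsub>G\<lparr>carrier := H\<rparr>\<^esub> order (G\<lparr>carrier := H\<rparr>) = \<one>\<^bsub>G\<lparr>carrier := H\<rparr>\<^esub>"
    by (rule H.pow_order_eq_1) (use assms in simp)
  then have "x [^] card H = \<one>"
    by (simp add: order_def nat_pow_consistent[symmetric])
  then show ?thesis
    using assms subgroup.mem_carrier pow_eq_id by metis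
qed

lemma (in group_hom) card_dvd_order_of_surj:
  assumes "h ` carrier G = carrier H"
  shows "card (carrier H) dvd order G"
proof -
  have "card (carrier (G Mod kernel G H h)) = card (carrier H)"
    using FactGroup_iso[OF assms] iso_same_card by blast
  moreover have "card (rcosets (kernel G H h)) * card (kernel G H h) = order G"
    by (rule G.lagrange[OF subgroup_kernel])
  ultimately show ?thesis
    by (metis FactGroup_def dvd_triv_left partial_object.select_convs(1))
qed

text \<open>The projection \<phi> from \<open>G\<close> to \<open>E\<close> restricts to an
  isomorphism on \<open>J\<close>. It is injective there because its kernel lies in a normal
  subgroup \<open>N\<close> of order prime to \<open>p\<close>. It is onto because \<open>E\<close>
  is a p-group whose order divides that of \<open>G\<close>, so \<open>E\<close> is no larger than
  \<open>J\<close>.\<close>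

lemma sylow_subgroup_macdonald_iso:
  assumes \<alpha>: "\<alpha> \<notin> {0, 1, 2}" and p: "Factorial_Ring.prime p" "int p dvd \<alpha> - 1"
    and J: "sylow_subgroup p J (macdonald_group \<alpha>)"
  shows "(macdonald_group \<alpha>)\<lparr>carrier := J\<rparr> \<cong> macdonald_exp_group \<alpha> (p ^ macdonald_height \<alpha> p)"
proof -
  define e where "e = macdonald_height \<alpha> p"
  define R where "R = macdonald_rels \<alpha>"
  define R' where "R' = macdonald_rels \<alpha> \<union>
    {(word_pow (gen Gen_x) (int (p ^ e)), []), (word_pow (gen Gen_y) (int (p ^ e)), [])}"
  define G where "G = presented_group R"
  define E where "E = presented_group R'"
  let ?A = "word_class R (gen Gen_x)" and ?B = "word_class R (gen Gen_y)"
    and ?C = "word_class R (word_comm (gen Gen_x) (gen Gen_y))"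
  let ?a = "word_class R' (gen Gen_x)" and ?b = "word_class R' (gen Gen_y)"
    and ?c = "word_class R' (word_comm (gen Gen_x) (gen Gen_y))"
  interpret G: macdonald_generated G \<alpha> ?A ?B ?C
    unfolding G_def by (rule macdonald_generated_presented_group) (simp add: R_def)
  interpret E: macdonald_generated E \<alpha> ?a ?b ?c
    unfolding E_def by (rule macdonald_generated_presented_group) (auto simp: R'_def)
  have J: "subgroup J G" "card J = p ^ multiplicity p (order G)"
    using J by (simp_all add: sylow_subgroup_def macdonald_group_def G_def R_def)
  obtain n where n: "n > 0" "?A [^]\<^bsub>G\<^esub> n = \<one>\<^bsub>G\<^esub>" "?B [^]\<^bsub>G\<^esub> n = \<one>\<^bsub>G\<^esub>"
    "\<And>q. Factorial_Ring.prime q \<Longrightarrow> q dvd n \<Longrightarrow> int q dvd \<alpha> - 1" "\<not> p ^ Suc e dvd n"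
    unfolding e_def using G.exponent_exists[OF \<alpha> p] by blast
  define f where "f = multiplicity p n"
  have punit: "\<not> is_unit p"
    using p(1) by (simp add: prime_nat_iff)
  obtain d where d: "n = p ^ f * d" "\<not> p dvd d"
    using multiplicity_decompose'[of n p] n(1) punit unfolding f_def by blast
  have "f \<le> e"
    using multiplicity_dvd'[of "Suc e" p n] n(5) unfolding f_def by (meson not_less_eq_eq)
  have finG: "finite (carrier G)"
    by (rule G.finite_and_prime_dvd_order(1)[OF n(1-4)])
  have one_normal: "{\<one>\<^bsub>G\<^esub>} \<lhd> G"
    by (rule G.one_is_normal)
  \<comment> \<open>\<open>d\<close> is the part of \<open>n\<close> prime to \<open>p\<close>; once
    its primes are peeled off, \<open>p ^ f\<close> kills both generators modulo
    \<open>N\<close>.\<close>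
  have "\<exists>N. N \<lhd> G \<and> ?A [^]\<^bsub>G\<^esub> (p ^ f) \<in> N \<and> ?B [^]\<^bsub>G\<^esub> (p ^ f) \<in> N \<and> finite N
    \<and> (\<forall>r. Factorial_Ring.prime r \<longrightarrow> r dvd card N \<longrightarrow> r dvd card {\<one>\<^bsub>G\<^esub>} \<or> r dvd d)"
  proof (rule G.normal_extension[OF one_normal])
    show "int l dvd \<alpha> - 1" if "Factorial_Ring.prime l" "l dvd d * p ^ f" for l
      using n(4)[OF that(1)] that(2) by (simp add: d(1) mult.commute)
    show "?A [^]\<^bsub>G\<^esub> (d * p ^ f) \<in> {\<one>\<^bsub>G\<^esub>}" "?B [^]\<^bsub>G\<^esub> (d * p ^ f) \<in> {\<one>\<^bsub>G\<^esub>}"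
      using n(2,3) by (simp_all add: d(1) mult.commute)
    show "d > 0"
      using n(1) d(1) by simp
  qed (use p(1) in \<open>simp_all add: prime_gt_0_nat\<close>)
  then obtain N where N: "N \<lhd> G" "?A [^]\<^bsub>G\<^esub> (p ^ f) \<in> N" "?B [^]\<^bsub>G\<^esub> (p ^ f) \<in> N" "finite N"
    and N_prime: "\<And>r. Factorial_Ring.prime r \<Longrightarrow> r dvd card N \<Longrightarrow> r dvd card {\<one>\<^bsub>G\<^esub>} \<or> r dvd d"
    by blast
  have subN: "subgroup N G"
    using N(1) by (rule normal_imp_subgroup)
  have "\<not> p dvd card N"
    using N_prime[OF p(1)] d(2) punit by auto
  then have cop: "coprime (card J) (card N)"
    using p(1) by (simp add: J(2) prime_imp_coprime)
  have N_pow: "x [^]\<^bsub>G\<^esub> (p ^ e) \<in> N" if "x \<in> carrier G" "x [^]\<^bsub>G\<^esub> (p ^ f) \<in> N" for x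
  proof -
    have "x [^]\<^bsub>G\<^esub> (p ^ e) = (x [^]\<^bsub>G\<^esub> (p ^ f)) [^]\<^bsub>G\<^esub> (p ^ (e - f))"
      using \<open>f \<le> e\<close> that(1) by (simp add: G.nat_pow_pow flip: power_add)
    then show ?thesis
      using G.subgroup_int_pow_closed[OF subN that(2), of "int (p ^ (e - f))"] by (simp only: int_pow_int)
  qed
  obtain \<phi> where \<phi>: "\<phi> \<in> hom G E" "\<And>w. \<phi> (word_class R w) = word_class R' w"
    unfolding G_def E_def using presented_group_hom_of_subset[of R R'] by (auto simp: R_def R'_def)
  interpret phi: group_hom G E \<phi>
    using \<phi>(1) by unfold_locales
  have G_word: "\<exists>w. x = word_class R w" if "x \<in> carrier G" for x
    using that by (auto simp: G_def carrier_presented_group)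
  have surj: "\<phi> ` carrier G = carrier E"
    by (auto simp: G_def E_def carrier_presented_group \<phi>(2) image_image)
  have ker: "x \<in> N" if x: "x \<in> carrier G" "\<phi> x = \<one>\<^bsub>E\<^esub>" for x
  proof -
    interpret q: group_hom G "G Mod N" "\<lambda>x. N #>\<^bsub>G\<^esub> x"
      by (rule G.coset_group_hom[OF N(1)])
    define g where "g = (\<lambda>s. N #>\<^bsub>G\<^esub> word_class R (gen s))"
    have cl: "word_class R w \<in> carrier G" for w
      by (simp add: G_def)
    have ev: "word_eval (G Mod N) g w = N #>\<^bsub>G\<^esub> word_class R w" for w
      unfolding g_def q.word_eval_hom[of "\<lambda>s. word_class R (gen s)", OF cl]
      by (simp only: G_def word_eval_word_class)
    have pow_mem: "word_class R (word_pow (gen s) (int (p ^ e))) \<in> N" for s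
      using N_pow[OF cl[of "gen s"]] N(2,3) two_gens.exhaust[of s]
      unfolding word_class_pow G_def[symmetric] by (metis int_pow_int)
    \<comment> \<open>All relations of \<open>E\<close> hold in \<open>G Mod N\<close>, so the
      quotient map of \<open>G\<close> factors through \<phi>, and whatever \<phi> kills lies in
      \<open>N\<close>.\<close>
    have "\<exists>h\<in>hom E (G Mod N). \<forall>w. h (word_class R' w) = word_eval (G Mod N) g w"
      unfolding E_def
    proof (rule q.H.presented_group_universal)
      show "g s \<in> carrier (G Mod N)" for s
        unfolding g_def by (rule q.hom_closed[OF cl])
      fix u v assume "(u, v) \<in> R'"
      then consider "(u, v) \<in> R" | s where "u = word_pow (gen s) (int (p ^ e))" "v = []"
        by (auto simp: R_def R'_def)
      then show "word_eval (G Mod N) g u = word_eval (G Mod N) g v"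
      proof cases
        case 1
        then have "word_class R u = word_class R v"
          by (auto simp: word_class_eq_iff intro: word_equiv.rel)
        then show ?thesis
          unfolding ev by simp
      next
        case 2
        have "N #>\<^bsub>G\<^esub> word_class R u = \<one>\<^bsub>G Mod N\<^esub>"
          using G.coset_eq_one_iff[OF N(1) cl] pow_mem 2 by blast
        moreover have "word_eval (G Mod N) g v = \<one>\<^bsub>G Mod N\<^esub>"
          by (simp only: 2 word_eval_def foldr.simps id_apply)
        ultimately show ?thesis
          unfolding ev[of u] by simp
      qed
    qed
    then obtain h where h: "h \<in> hom E (G Mod N)" "\<And>w. h (word_class R' w) = N #>\<^bsub>G\<^esub> word_class R w"
      unfolding ev by blast
    obtain w where w: "x = word_class R w"
      using G_word[OF x(1)] by blast
    have "N #>\<^bsub>G\<^esub> x = h \<one>\<^bsub>E\<^esub>"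
      unfolding w h(2)[symmetric] \<phi>(2)[symmetric] using x(2) w by simp
    also have "\<dots> = \<one>\<^bsub>G Mod N\<^esub>"
      by (rule hom_one[OF h(1) E.is_group q.H.is_group])
    finally show ?thesis
      using G.coset_eq_one_iff[OF N(1) x(1)] by blast
  qed
  have inter: "x = \<one>\<^bsub>G\<^esub>" if "x \<in> J" "x \<in> N" for x
  proof -
    have "G.ord x dvd card J" "G.ord x dvd card N"
      using G.ord_dvd_card_subgroup J(1) subN that by blast+
    then have "G.ord x = 1"
      using cop coprime_common_divisor_nat by blast
    then show ?thesis
      using G.ord_eq_1 subgroup.mem_carrier[OF J(1) that(1)] by blast
  qed
  have pe: "word_class R' (gen s) [^]\<^bsub>E\<^esub> (p ^ e) = \<one>\<^bsub>E\<^esub>" for s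
  proof -
    have "word_class R' (word_pow (gen s) (int (p ^ e))) = word_class R' []"
      unfolding word_class_eq_iff by (cases s) (auto simp: R'_def intro!: word_equiv.rel)
    then show ?thesis
      unfolding word_class_pow E_def[symmetric] int_pow_int by (simp add: E_def one_presented_group)
  qed
  have pe_prime: "q = p" if "Factorial_Ring.prime q" "q dvd p ^ e" for q
    using that p(1) prime_dvd_power primes_dvd_imp_eq by blast
  have finE: "finite (carrier E)" and E_prime: "\<And>r. Factorial_Ring.prime r \<Longrightarrow> r dvd order E \<Longrightarrow> r dvd p ^ e"
    using E.finite_and_prime_dvd_order[of "p ^ e"] pe pe_prime p by (auto simp: prime_gt_0_nat)
  have "order E dvd order G"
    using phi.card_dvd_order_of_surj[OF surj] by (simp add: order_def)
  have orders: "order G > 0" "order E > 0"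
    using finG finE G.order_gt_0_iff_finite E.order_gt_0_iff_finite by blast+
  obtain t y where y: "order E = p ^ t * y" "\<not> p dvd y"
    using multiplicity_decompose'[of "order E" p] orders(2) punit by (metis less_irrefl)
  have "y = 1"
  proof (rule ccontr)
    assume "y \<noteq> 1"
    then obtain r where r: "Factorial_Ring.prime r" "r dvd y"
      using prime_factor_nat by blast
    then have "r = p"
      using E_prime[of r] y(1) pe_prime by simp
    then show False
      using r(2) y(2) by simp
  qed
  with y(1) have t: "order E = p ^ t"
    by simp
  \<comment> \<open>\<open>p ^ t\<close> divides \<open>order G\<close>, so it is at most the order
    of a Sylow subgroup.\<close>
  have "t \<le> multiplicity p (order G)"
    using \<open>order E dvd order G\<close> orders punit by (simp add: t power_dvd_iff_le_multiplicity)
  then have le: "card (carrier E) \<le> card J"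
    using t p(1) by (simp add: J(2) order_def prime_gt_0_nat power_increasing Suc_leI)
  interpret J: group "G\<lparr>carrier := J\<rparr>"
    by (rule G.subgroup_imp_group[OF J(1)])
  have J_sub: "J \<subseteq> carrier G"
    by (rule subgroup.subset[OF J(1)])
  have homJ: "\<phi> \<in> hom (G\<lparr>carrier := J\<rparr>) E"
  proof (rule homI)
    show "\<phi> x \<in> carrier E" if "x \<in> carrier (G\<lparr>carrier := J\<rparr>)" for x
      using that J_sub phi.hom_closed by auto
    show "\<phi> (x \<otimes>\<^bsub>G\<lparr>carrier := J\<rparr>\<^esub> y) = \<phi> x \<otimes>\<^bsub>E\<^esub> \<phi> y"
      if "x \<in> carrier (G\<lparr>carrier := J\<rparr>)" "y \<in> carrier (G\<lparr>carrier := J\<rparr>)" for x y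
      using that phi.hom_mult[OF subsetD[OF J_sub] subsetD[OF J_sub], of x y] by simp
  qed
  interpret phiJ: group_hom "G\<lparr>carrier := J\<rparr>" E \<phi>
    using homJ by unfold_locales
  have "inj_on \<phi> J"
    using phiJ.inj_on_one_iff inter ker J_sub by auto
  moreover have "\<phi> ` J = carrier E"
  proof (rule card_subset_eq[OF finE])
    show "\<phi> ` J \<subseteq> carrier E"
      using J_sub surj by blast
    then have "card (\<phi> ` J) \<le> card (carrier E)"
      by (rule card_mono[OF finE])
    with le show "card (\<phi> ` J) = card (carrier E)"
      using card_image[OF \<open>inj_on \<phi> J\<close>] by simp
  qed
  ultimately have "\<phi> \<in> iso (G\<lparr>carrier := J\<rparr>) E"
    using homJ by (simp add: iso_def bij_betw_def)
  then show ?thesis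
    by (auto simp: is_iso_def macdonald_group_def macdonald_exp_group_def G_def E_def R_def R'_def e_def)
qed

theorem theorem5p3:
  fixes \<alpha> :: int and p m :: nat and J :: "two_gens word set set"
  assumes "\<alpha> \<notin> {0, 1, 2}"
    and "Factorial_Ring.prime p" and "int p dvd \<alpha> - 1"
    and "m = multiplicity (int p) (\<alpha> - 1)"
    and "sylow_subgroup p J (macdonald_group \<alpha>)"
  shows "(p > 3 \<or> (p = 3 \<and> (m > 1 \<or> [(\<alpha> - 1) div 3 = 1] (mod 3))) \<longrightarrow>
            (macdonald_group \<alpha>)\<lparr>carrier := J\<rparr> \<cong> macdonald_exp_group \<alpha> (p ^ (3 * m)))
       \<and> (p = 2 \<longrightarrow>
            (macdonald_group \<alpha>)\<lparr>carrier := J\<rparr> \<cong> macdonald_exp_group \<alpha> (2 ^ (3 * m - 1)))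
       \<and> (p = 3 \<and> m = 1 \<and> [(\<alpha> - 1) div 3 = - 1] (mod 3) \<longrightarrow>
            (macdonald_group \<alpha>)\<lparr>carrier := J\<rparr> \<cong> macdonald_exp_group \<alpha> 81)"
proof -
  have iso: "(macdonald_group \<alpha>)\<lparr>carrier := J\<rparr> \<cong> macdonald_exp_group \<alpha> (p ^ macdonald_height \<alpha> p)"
    by (rule sylow_subgroup_macdonald_iso) (fact assms)+
  have h: "macdonald_height \<alpha> p = (if p = 2 then 3 * m - 1
      else if p = 3 \<and> m = 1 \<and> [(\<alpha> - 1) div 3 = - 1] (mod 3) then 4 else 3 * m)"
    unfolding macdonald_height_def assms(4) Let_def ..
  show ?thesis
  proof (intro conjI impI)
    assume "p > 3 \<or> (p = 3 \<and> (m > 1 \<or> [(\<alpha> - 1) div 3 = 1] (mod 3)))"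
    \<comment> \<open>At \<open>p = 3\<close> the value 4 is excluded either by \<open>m > 1\<close>
      or because 1 and -1 differ modulo 3.\<close>
    then have "macdonald_height \<alpha> p = 3 * m"
      unfolding h by (auto simp: cong_def)
    with iso show "(macdonald_group \<alpha>)\<lparr>carrier := J\<rparr> \<cong> macdonald_exp_group \<alpha> (p ^ (3 * m))"
      by metis
  next
    assume "p = 2"
    then have "macdonald_height \<alpha> p = 3 * m - 1"
      unfolding h by simp
    with iso \<open>p = 2\<close> show "(macdonald_group \<alpha>)\<lparr>carrier := J\<rparr> \<cong> macdonald_exp_group \<alpha> (2 ^ (3 * m - 1))"
      by metis
  next
    assume "p = 3 \<and> m = 1 \<and> [(\<alpha> - 1) div 3 = - 1] (mod 3)"
    then have "p ^ macdonald_height \<alpha> p = 81"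
      unfolding h by simp
    with iso show "(macdonald_group \<alpha>)\<lparr>carrier := J\<rparr> \<cong> macdonald_exp_group \<alpha> 81"
      by simp
  qed
qed

end
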